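(* Let $E\subset\mathbb{R}^n$ be a non-empty set. Then the following statements are equivalent. (I) There exist $C_0>0$ and $0<s<(1+2^n)^{-1}$ such that $$0<\frac{\sup\{L\geq0:\sum_{Q\in\mathcal{D}_E(Q_0),\,l(Q)\geq L}|Q|\geq s|Q_0|\}}{\inf\{L\geq0:\sum_{Q\in\mathcal{D}_E(Q_0),\,l(Q)\leq L}|Q|\geq s|Q_0|\}}\leq C_0$$ for every cube $Q_0\subset\mathbb{R}^n$ with $Q_0\cap\overline{E}\neq\emptyset$. (II) For any $p\in(1,\infty)$ there exists $\theta\in\mathbb{R}\setminus\{0\}$ such that $\operatorname{dist}(\cdot,E)^\theta\in A_p$.
   Context: $|A|$ is the Lebesgue measure of $A$ and $\overline{E}$ the closure of $E$. A cube in $\mathbb{R}^n$ is a half-open set $Q=[a_1,b_1)\times\cdots\times[a_n,b_n)$ with $b_i-a_i>0$ the same for all $i$; this common value is the side length $l(Q)$. For a cube $Q_0$, $\mathcal{D}(Q_0)=\bigcup_{j\geq0}\mathcal{D}^j(Q_0)$, where $\mathcal{D}^j(Q_0)$ is the family of $2^{jn}$ pairwise disjoint cubes of side length $2^{-j}l(Q_0)$ whose union is $Q_0$. For $Q\in\mathcal{D}^j(Q_0)$ with $j\geq1$, the dyadic parent $\pi Q$ is the unique cube of $\mathcal{D}^{j-1}(Q_0)$ containing $Q$. Define $\mathcal{D}_E(Q_0)=\{Q\in\mathcal{D}(Q_0): Q\cap\overline{E}=\emptyset \text{ and } \pi Q\cap\overline{E}\neq\emptyset\}$. Conventions: $\sup\emptyset=0$,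 $\inf\emptyset=\infty$ (so the positivity of the quotient forces both sets to be non-empty). $\operatorname{dist}(x,E)=\inf_{e\in E}|x-e|$; negative powers of $0$ equal $+\infty$. A weight is a locally integrable function $w$ on $\mathbb{R}^n$ with $w>0$ a.e. For $1<p<\infty$, $w\in A_p$ means that $w$ is a weight and there is $C>0$ with $\left(\frac{1}{|Q|}\int_Q w\right)\left(\frac{1}{|Q|}\int_Q w^{-\frac{1}{p-1}}\right)^{p-1}\leq C$ for every cube $Q\subset\mathbb{R}^n$. *)

theory Defs
  imports "HOL-Analysis.Analysis"
begin

section \<open>Cubes and dyadic families\<close>

definition cube :: "real ^ 'n \<Rightarrow> real \<Rightarrow> (real ^ 'n) set" where
  "cube a l = {x. \<forall>i. a $ i \<le> x $ i \<and> x $ i < a $ i + l}"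

definition is_cube :: "(real ^ 'n) set \<Rightarrow> bool" where
  "is_cube Q \<longleftrightarrow> (\<exists>a l. 0 < l \<and> Q = cube a l)"

text \<open>The side length is determined by the set, see \<open>side_cube\<close> below.\<close>

definition side :: "(real ^ 'n) set \<Rightarrow> real" where
  "side Q = (THE l. 0 < l \<and> (\<exists>a. Q = cube a l))"

text \<open>The \<open>j\<close>-th dyadic generation as an explicit grid. The corner \<open>a\<close> and the side \<open>l\<close> are
  determined by \<open>Q0\<close>; the lemmas \<open>side_dyadic\<close>, \<open>disjoint_dyadic\<close>, \<open>Union_dyadic\<close> and
  \<open>card_dyadic\<close> are the defining properties of the family.\<close>

definition dyadic :: "nat \<Rightarrow> (real ^ 'n) set \<Rightarrow> (real ^ 'n) set set" where
  "dyadic j Q0 =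
    {cube (a + (l / 2 ^ j) *\<^sub>R (\<chi> i. real (k $ i))) (l / 2 ^ j) | a l (k :: nat ^ 'n).
      0 < l \<and> Q0 = cube a l \<and> (\<forall>i. k $ i < 2 ^ j)}"

definition dyadic_parent :: "nat \<Rightarrow> (real ^ 'n) set \<Rightarrow> (real ^ 'n) set \<Rightarrow> (real ^ 'n) set" where
  "dyadic_parent j Q0 Q = (THE P. P \<in> dyadic (j - 1) Q0 \<and> Q \<subseteq> P)"

text \<open>\<open>Q0\<close> itself has no parent and hence never belongs to this family.\<close>

definition dyadic_avoiding ::
  "(real ^ 'n) set \<Rightarrow> (real ^ 'n) set \<Rightarrow> (real ^ 'n) set set" where
  "dyadic_avoiding E Q0 =
    {Q. \<exists>j\<ge>1. Q \<in> dyadic j Q0 \<and> Q \<inter> closure E = {}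
          \<and> dyadic_parent j Q0 Q \<inter> closure E \<noteq> {}}"

text \<open>In \<^typ>\<open>ennreal\<close> we have \<open>Sup {} = 0\<close>, \<open>Inf {} = \<infinity>\<close> and \<open>x / \<infinity> = 0\<close> for all \<open>x\<close>.\<close>

definition upper_scale :: "(real ^ 'n) set \<Rightarrow> real \<Rightarrow> (real ^ 'n) set \<Rightarrow> ennreal" where
  "upper_scale E s Q0 =
    Sup {ennreal L | L. 0 \<le> L \<and>
      (\<Sum>\<^sub>\<infinity>Q\<in>{Q \<in> dyadic_avoiding E Q0. L \<le> side Q}. emeasure lebesgue Q)
        \<ge> ennreal s * emeasure lebesgue Q0}"

definition lower_scale :: "(real ^ 'n) set \<Rightarrow> real \<Rightarrow> (real ^ 'n) set \<Rightarrow> ennreal" where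
  "lower_scale E s Q0 =
    Inf {ennreal L | L. 0 \<le> L \<and>
      (\<Sum>\<^sub>\<infinity>Q\<in>{Q \<in> dyadic_avoiding E Q0. side Q \<le> L}. emeasure lebesgue Q)
        \<ge> ennreal s * emeasure lebesgue Q0}"


section \<open>Weights and Muckenhoupt classes\<close>

text \<open>Weights take values in \<^typ>\<open>ennreal\<close>, because negative powers of 0 are \<open>\<infinity>\<close>.\<close>

definition epowr :: "ennreal \<Rightarrow> real \<Rightarrow> ennreal" where
  "epowr x t =
    (if t = 0 then 1
     else if x = 0 then (if t < 0 then \<infinity> else 0)
     else if x = \<infinity> then (if t < 0 then 0 else \<infinity>)
     else ennreal (enn2real x powr t))"

definition weight :: "(real ^ 'n \<Rightarrow> ennreal) \<Rightarrow> bool" where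
  "weight w \<longleftrightarrow>
    w \<in> borel_measurable lebesgue \<and>
    (\<forall>K. compact K \<longrightarrow> (\<integral>\<^sup>+x\<in>K. w x \<partial>lebesgue) < \<infinity>) \<and>
    (AE x in lebesgue. 0 < w x)"

definition Muckenhoupt :: "real \<Rightarrow> (real ^ 'n \<Rightarrow> ennreal) set" where
  "Muckenhoupt p = {w. weight w \<and>
    (\<exists>C>0. \<forall>Q. is_cube Q \<longrightarrow>
      (\<integral>\<^sup>+x\<in>Q. w x \<partial>lebesgue) / emeasure lebesgue Q *
      epowr ((\<integral>\<^sup>+x\<in>Q. epowr (w x) (- 1 / (p - 1)) \<partial>lebesgue) / emeasure lebesgue Q) (p - 1)
        \<le> ennreal C)}"


section \<open>The definitions of side length, dyadic family and parent are as intended\<close>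

lemma cube_subsetD:
  assumes "0 < l" "cube a l \<subseteq> cube b m"
  shows "b $ i \<le> a $ i" "a $ i + l \<le> b $ i + m"
proof -
  have "a \<in> cube a l"
    using assms(1) by (auto simp: cube_def)
  with assms(2) show "b $ i \<le> a $ i"
    by (auto simp: cube_def)
  show "a $ i + l \<le> b $ i + m"
  proof (rule ccontr)
    assume less: "\<not> a $ i + l \<le> b $ i + m"
    define t where "t = max 0 (b $ i + m - a $ i)"
    have t: "0 \<le> t" "t < l" "b $ i + m \<le> a $ i + t"
      using less assms(1) by (auto simp: t_def)
    then have "a + (\<chi> j. t) \<in> cube a l"
      by (auto simp: cube_def)
    with assms(2) have "a + (\<chi> j. t) \<in> cube b m"
      by blast
    then show False
      using t(3) by (auto simp: cube_def dest!: spec[of _ i])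
  qed
qed

lemma cube_eq_iff:
  assumes "0 < l" "0 < m"
  shows "cube a l = cube b m \<longleftrightarrow> a = b \<and> l = m"
proof
  assume eq: "cube a l = cube b m"
  have "a $ i = b $ i \<and> l = m" for i
    using cube_subsetD[of l a b m i] cube_subsetD[of m b a l i] assms eq by fastforce
  then show "a = b \<and> l = m"
    by (simp add: vec_eq_iff)
qed simp

lemma side_cube: "0 < l \<Longrightarrow> side (cube a l) = l"
  unfolding side_def by (rule the_equality) (auto simp: cube_eq_iff)

lemma dyadic_cube:
  fixes a :: "real ^ 'n"
  assumes "0 < l"
  shows "dyadic j (cube a l) =
    (\<lambda>k :: nat ^ 'n. cube (a + (l / 2 ^ j) *\<^sub>R (\<chi> i. real (k $ i))) (l / 2 ^ j)) ` {k. \<forall>i. k $ i < 2 ^ j}"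
  using assms by (auto simp: dyadic_def cube_eq_iff)

lemma mem_grid_cube_iff:
  assumes "0 < h"
  shows "x \<in> cube (a + h *\<^sub>R (\<chi> i. real (k $ i))) h \<longleftrightarrow> (\<forall>i. \<lfloor>(x $ i - a $ i) / h\<rfloor> = int (k $ i))"
  using assms by (auto simp: cube_def floor_eq_iff field_simps)

lemma is_cube_dyadic:
  assumes "Q \<in> dyadic j Q0"
  shows "is_cube Q"
proof -
  from assms obtain b l where "0 < (l :: real)" "Q = cube b (l / 2 ^ j)"
    by (auto simp: dyadic_def)
  then show ?thesis
    unfolding is_cube_def by (intro exI[of _ b] exI[of _ "l / 2 ^ j"]) simp
qed

lemma side_dyadic: "Q \<in> dyadic j Q0 \<Longrightarrow> side Q = side Q0 / 2 ^ j"
  by (auto simp: dyadic_def side_cube)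

lemma disjoint_dyadic:
  fixes Q0 :: "(real ^ 'n) set"
  assumes "is_cube Q0"
  shows "disjoint (dyadic j Q0)"
proof -
  obtain a l where l: "0 < l" and Q0: "Q0 = cube a l"
    using assms by (auto simp: is_cube_def)
  show ?thesis
  proof (rule disjointI)
    fix P Q
    assume "P \<in> dyadic j Q0" "Q \<in> dyadic j Q0" and ne: "P \<noteq> Q"
    then obtain k k' :: "nat ^ 'n" where
        P: "P = cube (a + (l / 2 ^ j) *\<^sub>R (\<chi> i. real (k $ i))) (l / 2 ^ j)"
      and Q: "Q = cube (a + (l / 2 ^ j) *\<^sub>R (\<chi> i. real (k' $ i))) (l / 2 ^ j)"
      unfolding Q0 dyadic_cube[OF l] by blast
    have "k = k'" if "x \<in> P" "x \<in> Q" for x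
      using that l unfolding P Q by (simp add: mem_grid_cube_iff vec_eq_iff)
    with ne show "P \<inter> Q = {}"
      unfolding P Q by blast
  qed
qed

lemma Union_dyadic:
  fixes Q0 :: "(real ^ 'n) set"
  assumes "is_cube Q0"
  shows "\<Union> (dyadic j Q0) = Q0"
proof -
  obtain a l where l: "0 < l" and Q0: "Q0 = cube a l"
    using assms by (auto simp: is_cube_def)
  define h where "h = l / 2 ^ j"
  have h: "0 < h" "l = h * 2 ^ j"
    using l by (simp_all add: h_def)
  have "x \<in> cube a l \<longleftrightarrow> (\<exists>k :: nat ^ 'n. (\<forall>i. k $ i < 2 ^ j) \<and> (\<forall>i. \<lfloor>(x $ i - a $ i) / h\<rfloor> = int (k $ i)))"
    for x
  proof
    assume x: "x \<in> cube a l"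
    define k :: "nat ^ 'n" where "k = (\<chi> i. nat \<lfloor>(x $ i - a $ i) / h\<rfloor>)"
    have nonneg: "0 \<le> \<lfloor>(x $ i - a $ i) / h\<rfloor>" for i
      using x h(1) by (auto simp: cube_def)
    have "(x $ i - a $ i) / h < 2 ^ j" for i
    proof -
      have "x $ i < a $ i + l"
        using x by (auto simp: cube_def)
      then show ?thesis
        using h by (simp add: field_simps)
    qed
    then have "\<lfloor>(x $ i - a $ i) / h\<rfloor> < 2 ^ j" for i
      by (simp add: floor_less_iff)
    then have "k $ i < 2 ^ j" for i
      using nonneg[of i] by (simp add: k_def nat_less_iff)
    moreover have "\<lfloor>(x $ i - a $ i) / h\<rfloor> = int (k $ i)" for i
      using nonneg[of i] by (simp add: k_def)
    ultimately show "\<exists>k :: nat ^ 'n. (\<forall>i. k $ i < 2 ^ j) \<and> (\<forall>i. \<lfloor>(x $ i - a $ i) / h\<rfloor> = int (k $ i))"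
      by blast
  next
    assume "\<exists>k :: nat ^ 'n. (\<forall>i. k $ i < 2 ^ j) \<and> (\<forall>i. \<lfloor>(x $ i - a $ i) / h\<rfloor> = int (k $ i))"
    then obtain k :: "nat ^ 'n" where k: "\<And>i. k $ i < 2 ^ j" "\<And>i. \<lfloor>(x $ i - a $ i) / h\<rfloor> = int (k $ i)"
      by blast
    have "a $ i \<le> x $ i \<and> x $ i < a $ i + l" for i
    proof -
      have "real (k $ i) \<le> (x $ i - a $ i) / h" "(x $ i - a $ i) / h < real (k $ i) + 1"
        using k(2)[of i] by (simp_all add: floor_eq_iff)
      moreover have "real (k $ i) + 1 \<le> 2 ^ j"
        using k(1)[of i] by (metis Suc_leI of_nat_Suc of_nat_le_iff of_nat_numeral of_nat_power add.commute)
      ultimately have "0 \<le> (x $ i - a $ i) / h" "(x $ i - a $ i) / h < 2 ^ j"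
        by linarith+
      then show ?thesis
        using h by (simp add: field_simps zero_le_divide_iff)
    qed
    then show "x \<in> cube a l"
      by (simp add: cube_def)
  qed
  then show ?thesis
    unfolding Q0 dyadic_cube[OF l] h_def[symmetric]
    by (auto simp: mem_grid_cube_iff h(1)) blast
qed

lemma card_dyadic:
  fixes Q0 :: "(real ^ 'n) set"
  assumes "is_cube Q0"
  shows "card (dyadic j Q0) = 2 ^ (j * CARD('n))"
proof -
  obtain a l where l: "0 < l" and Q0: "Q0 = cube a l"
    using assms by (auto simp: is_cube_def)
  have "{k :: nat ^ 'n. \<forall>i. k $ i < 2 ^ j} = vec_lambda ` (UNIV \<rightarrow>\<^sub>E {..<2 ^ j})"
  proof safe
    fix k :: "nat ^ 'n"
    assume "\<forall>i. k $ i < 2 ^ j"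
    then show "k \<in> vec_lambda ` (UNIV \<rightarrow>\<^sub>E {..<2 ^ j})"
      by (intro image_eqI[of _ _ "($) k"]) (auto simp: PiE_def Pi_def vec_lambda_eta)
  qed (auto simp: PiE_def Pi_def)
  moreover have "inj_on vec_lambda (UNIV \<rightarrow>\<^sub>E {..<2 ^ j :: nat} :: ('n \<Rightarrow> nat) set)"
    by (auto simp: inj_on_def vec_lambda_inject)
  ultimately have "card {k :: nat ^ 'n. \<forall>i. k $ i < 2 ^ j} = card (UNIV \<rightarrow>\<^sub>E {..<2 ^ j} :: ('n \<Rightarrow> nat) set)"
    by (simp add: card_image)
  also have "\<dots> = 2 ^ (j * CARD('n))"
    by (simp add: card_PiE power_mult)
  finally have "card {k :: nat ^ 'n. \<forall>i. k $ i < 2 ^ j} = 2 ^ (j * CARD('n))" .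
  moreover have "inj_on (\<lambda>k :: nat ^ 'n. cube (a + (l / 2 ^ j) *\<^sub>R (\<chi> i. real (k $ i))) (l / 2 ^ j))
      {k. \<forall>i. k $ i < 2 ^ j}"
    using l by (auto simp: inj_on_def cube_eq_iff vec_eq_iff)
  ultimately show ?thesis
    unfolding Q0 dyadic_cube[OF l] by (simp add: card_image)
qed

lemma ex1_dyadic_parent:
  fixes Q0 :: "(real ^ 'n) set"
  assumes "is_cube Q0" "1 \<le> j" "Q \<in> dyadic j Q0"
  shows "\<exists>!P. P \<in> dyadic (j - 1) Q0 \<and> Q \<subseteq> P"
proof -
  obtain a l where l: "0 < l" and Q0: "Q0 = cube a l"
    using assms(1) by (auto simp: is_cube_def)
  obtain i where j: "j = Suc i"
    using assms(2) by (cases j) auto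
  define h where "h = l / 2 ^ j"
  have h: "0 < h" "l / 2 ^ i = 2 * h"
    using l by (simp_all add: h_def j)
  obtain k :: "nat ^ 'n" where k: "\<And>i. k $ i < 2 ^ j" and Q: "Q = cube (a + h *\<^sub>R (\<chi> i. real (k $ i))) h"
    using assms(3) unfolding Q0 dyadic_cube[OF l] h_def by auto
  define k' :: "nat ^ 'n" where "k' = (\<chi> i. k $ i div 2)"
  define P where "P = cube (a + (l / 2 ^ i) *\<^sub>R (\<chi> i. real (k' $ i))) (l / 2 ^ i)"
  have P: "P \<in> dyadic i Q0"
  proof -
    have "k' $ m < 2 ^ i" for m
      using k[of m] by (simp add: k'_def j less_mult_imp_div_less mult.commute)
    then show ?thesis
      unfolding Q0 dyadic_cube[OF l] P_def by blast
  qed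
  have "Q \<subseteq> P"
  proof
    fix x assume "x \<in> Q"
    then have x: "\<lfloor>(x $ m - a $ m) / h\<rfloor> = int (k $ m)" for m
      using h(1) unfolding Q by (simp add: mem_grid_cube_iff)
    have "\<lfloor>(x $ m - a $ m) / (2 * h)\<rfloor> = int (k' $ m)" for m
    proof -
      have "\<lfloor>(x $ m - a $ m) / (2 * h)\<rfloor> = \<lfloor>((x $ m - a $ m) / h) / real_of_int 2\<rfloor>"
        by (simp add: mult.commute)
      also have "\<dots> = \<lfloor>(x $ m - a $ m) / h\<rfloor> div 2"
        by (rule floor_divide_real_eq_div) simp
      finally show ?thesis
        by (simp add: x k'_def)
    qed
    then show "x \<in> P"
      using h unfolding P_def h(2) by (simp add: mem_grid_cube_iff)
  qed
  show ?thesis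
  proof (rule ex1I[of _ P])
    show "P \<in> dyadic (j - 1) Q0 \<and> Q \<subseteq> P"
      using P \<open>Q \<subseteq> P\<close> by (simp add: j)
  next
    fix P' assume P': "P' \<in> dyadic (j - 1) Q0 \<and> Q \<subseteq> P'"
    have "a + h *\<^sub>R (\<chi> i. real (k $ i)) \<in> Q"
      using h(1) unfolding Q by (auto simp: cube_def)
    then have "P' \<inter> P \<noteq> {}"
      using P' \<open>Q \<subseteq> P\<close> by blast
    moreover have "disjoint (dyadic i Q0)"
      by (rule disjoint_dyadic[OF assms(1)])
    ultimately show "P' = P"
      using P P' by (auto simp: disjoint_def j)
  qed
qed

end

theory Submission
  imports Defs
begin

text \<open>
  Let \<open>f\<close> be the function on a cube \<open>Q0\<close> whose value on each maximal dyadic subcube avoiding the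
  closure of \<open>E\<close> is the side of that subcube. The distance to \<open>E\<close> is at most a constant times \<open>f\<close>,
  and it is below \<open>t * f\<close> only on a set of relative size \<open>O(t)\<close>, near the boundaries of the
  subcubes. The two scales are \<open>s\<close>-quantiles of \<open>f\<close> from above and from below.

  If \<open>d\<^sup>\<theta> \<in> A\<^sub>2\<close> for the distance \<open>d\<close>, then testing the two averages of the \<open>A\<^sub>2\<close> condition on the sets
  where \<open>f\<close> is large and where \<open>f\<close> is small bounds the ratio of the quantiles. Conversely, a bounded
  ratio says that \<open>ln f\<close> has bounded median oscillation on all dyadic cubes. Since
  \<open>s * (1 + 2 ^ n) < 1\<close>, the quantiles of a cube and of its parent are comparable, and the
  John-Stroemberg form of the John-Nirenberg argument yields exponential tails for \<open>ln f\<close>, hence for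
  \<open>ln d\<close>. So small positive and negative powers of \<open>d\<close> have comparable averages. A cube whose
  triple avoids the closure of \<open>E\<close> needs no argument, because \<open>d\<close> is comparable to a constant on it.
\<close>

section \<open>Cubes and dyadic families\<close>

text \<open>The scales of a cube refer to its own family of maximal avoiding subcubes, while the
  John-Nirenberg argument compares all dyadic subcubes of \<open>Q0\<close> at once. This works
  because the immediate parent alone decides maximality: the family of a dyadic subcube
  \<open>R\<close> is part of the family of \<open>Q0\<close>, so the single function
  \<open>f\<close> of \<open>Q0\<close> carries the scales of every \<open>R\<close> that meets the
  closure of \<open>E\<close>. A subcube that misses the closure has no meaningful scales, but
  \<open>f\<close> is constant on it, and that constant can serve as both quantiles. Since every
  point off the closure lies in such a cube of constancy, the stopping argument reaches each point
  without a differentiation theorem.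

  All estimates hold off the closure of \<open>E\<close>, which therefore has to be a null set. From
  the weight this follows because a nonzero power of the distance is 0 or infinite on the closure.
  From the scales it follows because a positive upper scale keeps the density of the closure in
  every cube below a constant less than 1.\<close>

lemma cube_sets_borel [measurable]:
  fixes a :: "real ^ 'n"
  shows "cube a l \<in> sets borel"
  unfolding cube_def by measurable

lemma cube_sets_lebesgue [simp]: "cube a l \<in> sets lebesgue"
  using cube_sets_borel by (rule sets_completionI_sets[where M = lborel, simplified])

lemma emeasure_cube:
  fixes a :: "real ^ 'n"
  assumes "0 \<le> l"
  shows "emeasure lebesgue (cube a l) = ennreal (l ^ CARD('n))"
proof -
  define b where "b = a + (\<chi> i. l)"
  have box: "emeasure lborel (box a b) = ennreal (l ^ CARD('n))"
    and cbox: "emeasure lborel (cbox a b) = ennreal (l ^ CARD('n))"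
  proof -
    have ab: "a \<bullet> i \<le> b \<bullet> i" "(b - a) \<bullet> i = l" if "i \<in> Basis" for i
      using that assms by (auto simp: b_def Basis_vec_def inner_axis)
    have "(\<Prod>i\<in>Basis. (b - a) \<bullet> i) = l ^ CARD('n)"
      by (simp add: ab(2))
    with ab(1) show "emeasure lborel (box a b) = ennreal (l ^ CARD('n))"
      "emeasure lborel (cbox a b) = ennreal (l ^ CARD('n))"
      by (simp_all add: emeasure_lborel_box emeasure_lborel_cbox)
  qed
  have sub: "box a b \<subseteq> cube a l" "cube a l \<subseteq> cbox a b"
    by (auto simp: cube_def b_def mem_box_cart less_imp_le)
  have "emeasure lborel (cube a l) = ennreal (l ^ CARD('n))"
    using emeasure_mono[OF sub(1), of lborel] emeasure_mono[OF sub(2), of lborel] box cbox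
    by (simp add: antisym)
  then show ?thesis
    by (simp add: emeasure_completion)
qed

lemma is_cubeI: "0 < l \<Longrightarrow> is_cube (cube a l)"
  unfolding is_cube_def by blast

lemma is_cube_sets: "is_cube Q \<Longrightarrow> Q \<in> sets lebesgue"
  by (auto simp: is_cube_def)

lemma is_cube_nonempty: "is_cube Q \<Longrightarrow> Q \<noteq> {}"
proof -
  assume "is_cube Q"
  then obtain a l where "0 < l" "Q = cube a l" by (auto simp: is_cube_def)
  then have "a \<in> Q" by (simp add: cube_def)
  then show ?thesis by blast
qed

lemma side_pos: "is_cube Q \<Longrightarrow> 0 < side Q"
  by (auto simp: is_cube_def side_cube)

lemma emeasure_is_cube:
  fixes Q :: "(real ^ 'n) set"
  assumes "is_cube Q"
  shows "emeasure lebesgue Q = ennreal (side Q ^ CARD('n))"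
proof -
  from assms obtain a l where "0 < l" "Q = cube a l" by (auto simp: is_cube_def)
  then show ?thesis using emeasure_cube[of l a] by (simp add: side_cube)
qed

lemma emeasure_is_cube_pos: "is_cube Q \<Longrightarrow> 0 < emeasure lebesgue Q"
  by (simp add: emeasure_is_cube side_pos)

lemma emeasure_is_cube_finite: "is_cube Q \<Longrightarrow> emeasure lebesgue Q < \<infinity>"
  by (simp add: emeasure_is_cube)

lemma dyadic_0: "is_cube Q \<Longrightarrow> dyadic 0 Q = {Q}"
proof -
  assume "is_cube Q"
  then obtain a l where l: "0 < l" and Q: "Q = cube a l" by (auto simp: is_cube_def)
  have "{k :: nat ^ 'a. \<forall>i. k $ i < 2 ^ 0} = {0}"
    by (auto simp: vec_eq_iff)
  then have "dyadic 0 (cube a l) = {cube (a + (l / 2 ^ 0) *\<^sub>R (\<chi> i. real ((0 :: nat ^ 'a) $ i))) (l / 2 ^ 0)}"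
    unfolding dyadic_cube[OF l] by simp
  also have "(\<chi> i. real ((0 :: nat ^ 'a) $ i)) = 0"
    by (simp add: vec_eq_iff)
  finally show ?thesis by (simp add: Q)
qed

lemma dyadic_subset: "is_cube Q \<Longrightarrow> R \<in> dyadic j Q \<Longrightarrow> R \<subseteq> Q"
  using Union_dyadic[of Q j] by blast

lemma finite_dyadic: "is_cube Q \<Longrightarrow> finite (dyadic j Q)"
  using card_dyadic[of Q j] by (metis card_ge_0_finite zero_less_numeral zero_less_power)

lemma dyadic_trans:
  fixes Q :: "(real ^ 'n) set"
  assumes "R \<in> dyadic i P" "P \<in> dyadic j Q"
  shows "R \<in> dyadic (i + j) Q"
proof -
  from assms(2) obtain a l and k :: "nat ^ 'n" where l: "0 < l" and Q: "Q = cube a l"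
    and k: "\<And>m. k $ m < 2 ^ j" and P: "P = cube (a + (l / 2 ^ j) *\<^sub>R (\<chi> i. real (k $ i))) (l / 2 ^ j)"
    by (auto simp: dyadic_def)
  have "0 < l / 2 ^ j" using l by simp
  from assms(1)[unfolded P dyadic_cube[OF this]] obtain m :: "nat ^ 'n" where m: "\<And>i'. m $ i' < 2 ^ i"
    and R: "R = cube (a + (l / 2 ^ j) *\<^sub>R (\<chi> i. real (k $ i)) +
        (l / 2 ^ j / 2 ^ i) *\<^sub>R (\<chi> i. real (m $ i))) (l / 2 ^ j / 2 ^ i)"
    by blast
  \<comment> \<open>Grid coordinates concatenate like binary digits: \<open>k\<close> supplies the
    leading \<open>j\<close> digits and \<open>m\<close> the next \<open>i\<close>.\<close>
  define r :: "nat ^ 'n" where "r = (\<chi> t. 2 ^ i * k $ t + m $ t)"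
  have r: "r $ t < 2 ^ (i + j)" for t
  proof -
    have "r $ t < 2 ^ i * (k $ t + 1)" using m[of t] by (simp add: r_def)
    also have "\<dots> \<le> 2 ^ i * 2 ^ j" using k[of t] by (intro mult_left_mono) auto
    finally show ?thesis by (simp add: power_add)
  qed
  have "a + (l / 2 ^ j) *\<^sub>R (\<chi> i. real (k $ i)) + (l / 2 ^ j / 2 ^ i) *\<^sub>R (\<chi> i. real (m $ i))
      = a + (l / 2 ^ (i + j)) *\<^sub>R (\<chi> i. real (r $ i))"
    by (simp add: vec_eq_iff r_def power_add field_simps)
  then have "R = cube (a + (l / 2 ^ (i + j)) *\<^sub>R (\<chi> i. real (r $ i))) (l / 2 ^ (i + j))"
    unfolding R by (simp add: power_add field_simps)
  with r l show ?thesis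
    unfolding Q dyadic_cube[OF l] by blast
qed

text \<open>The cube of \<open>dyadic (j - i) P\<close> through \<open>x\<close> is also a cube of
  level \<open>j\<close> in \<open>Q\<close>, and disjointness of that level identifies it with
  \<open>R\<close>.\<close>

lemma dyadic_nested:
  assumes Q: "is_cube Q" and "P \<in> dyadic i Q" "R \<in> dyadic j Q" "i \<le> j" "x \<in> P" "x \<in> R"
  shows "R \<in> dyadic (j - i) P" "R \<subseteq> P"
proof -
  have P: "is_cube P" using assms(2) by (rule is_cube_dyadic)
  obtain R' where R': "R' \<in> dyadic (j - i) P" "x \<in> R'"
    using Union_dyadic[OF P, of "j - i"] \<open>x \<in> P\<close> by blast
  have "R' \<in> dyadic j Q"
    using dyadic_trans[OF R'(1) assms(2)] \<open>i \<le> j\<close> by simp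
  then have "R' = R"
    using disjoint_dyadic[OF Q, of j] assms(3,6) R'(2) unfolding disjoint_def by blast
  with R' show "R \<in> dyadic (j - i) P" by simp
  with P show "R \<subseteq> P" by (rule dyadic_subset)
qed

lemma emeasure_dyadic:
  fixes Q :: "(real ^ 'n) set"
  assumes "is_cube Q" "R \<in> dyadic j Q"
  shows "emeasure lebesgue Q = 2 ^ (j * CARD('n)) * emeasure lebesgue R"
proof -
  have "side Q = 2 ^ j * side R"
    using side_dyadic[OF assms(2)] by simp
  then have "side Q ^ CARD('n) = 2 ^ (j * CARD('n)) * side R ^ CARD('n)"
    by (simp add: power_mult_distrib power_mult)
  then show ?thesis
    using assms is_cube_dyadic[OF assms(2)] side_pos[OF is_cube_dyadic[OF assms(2)]]
    by (simp add: emeasure_is_cube ennreal_mult ennreal_power[symmetric])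
qed

text \<open>The scales are defined by unordered sums in \<open>ennreal\<close>; this turns such sums
  into measures of unions, so that measure theory applies to them.\<close>

lemma infsum_emeasure_disjoint:
  assumes "countable A" "disjoint A" "A \<subseteq> sets M"
  shows "(\<Sum>\<^sub>\<infinity>Q\<in>A. emeasure M Q) = emeasure M (\<Union>A)"
proof (cases "finite A")
  case True
  then have "(\<Sum>Q\<in>A. emeasure M (id Q)) = emeasure M (\<Union>Q\<in>A. id Q)"
    using assms by (intro sum_emeasure) (auto simp: disjoint_family_on_def disjoint_def)
  with True show ?thesis by simp
next
  case False
  let ?f = "from_nat_into A"
  have bij: "bij_betw ?f UNIV A"
    using bij_betw_from_nat_into assms(1) False by blast
  have "(\<Sum>\<^sub>\<infinity>Q\<in>A. emeasure M Q) = (\<Sum>\<^sub>\<infinity>i. emeasure M (?f i))"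
    using infsum_reindex_bij_betw[OF bij] by metis
  also have "\<dots> = (\<Sum>i. emeasure M (?f i))"
    by (intro sums_unique has_sum_imp_sums has_sum_infsum nonneg_summable_on_complete) simp
  also have "\<dots> = emeasure M (\<Union>i. ?f i)"
  proof (rule suminf_emeasure)
    show "range ?f \<subseteq> sets M" using bij assms(3) by (auto simp: bij_betw_def)
    show "disjoint_family ?f"
      unfolding disjoint_family_on_def
    proof (intro ballI impI)
      fix i j :: nat assume "i \<noteq> j"
      with bij have "?f i \<noteq> ?f j" "?f i \<in> A" "?f j \<in> A"
        by (auto simp: bij_betw_def inj_on_def)
      with assms(2) show "?f i \<inter> ?f j = {}" by (auto simp: disjoint_def)
    qed
  qed
  also have "(\<Union>i. ?f i) = \<Union>A"
    using bij by (simp add: bij_betw_def)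
  finally show ?thesis .
qed

section \<open>Maximal dyadic cubes that miss the closure of \<open>E\<close>\<close>

text \<open>Eliminates the definite description in \<open>dyadic_parent\<close>: the parent becomes
  a cube that has \<open>Q\<close> as a child, a form that composes with
  \<open>dyadic_trans\<close>.\<close>

lemma dyadic_avoiding_iff:
  fixes Q0 :: "(real ^ 'n) set"
  assumes Q0: "is_cube Q0"
  shows "Q \<in> dyadic_avoiding E Q0 \<longleftrightarrow> Q \<inter> closure E = {} \<and>
    (\<exists>j. \<exists>P\<in>dyadic j Q0. P \<inter> closure E \<noteq> {} \<and> Q \<in> dyadic 1 P)"
proof
  assume "Q \<in> dyadic_avoiding E Q0"
  then obtain j where j: "1 \<le> j" "Q \<in> dyadic j Q0" "Q \<inter> closure E = {}"
      "dyadic_parent j Q0 Q \<inter> closure E \<noteq> {}"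
    by (auto simp: dyadic_avoiding_def)
  let ?P = "dyadic_parent j Q0 Q"
  have P: "?P \<in> dyadic (j - 1) Q0" "Q \<subseteq> ?P"
    using theI'[OF ex1_dyadic_parent[OF Q0 j(1,2)]] unfolding dyadic_parent_def by blast+
  obtain x where "x \<in> Q" using is_cube_nonempty[OF is_cube_dyadic[OF j(2)]] by blast
  then have "Q \<in> dyadic 1 ?P"
    using dyadic_nested(1)[OF Q0 P(1) j(2) _ _ \<open>x \<in> Q\<close>] P(2) j(1) by auto
  with P j show "Q \<inter> closure E = {} \<and>
    (\<exists>j. \<exists>P\<in>dyadic j Q0. P \<inter> closure E \<noteq> {} \<and> Q \<in> dyadic 1 P)" by blast
next
  assume "Q \<inter> closure E = {} \<and> (\<exists>j. \<exists>P\<in>dyadic j Q0. P \<inter> closure E \<noteq> {} \<and> Q \<in> dyadic 1 P)"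
  then obtain j P where *: "Q \<inter> closure E = {}" "P \<in> dyadic j Q0" "P \<inter> closure E \<noteq> {}" "Q \<in> dyadic 1 P"
    by blast
  have Q: "Q \<in> dyadic (Suc j) Q0" using dyadic_trans[OF *(4,2)] by simp
  have "Q \<subseteq> P" using *(2,4) is_cube_dyadic dyadic_subset by blast
  then have "dyadic_parent (Suc j) Q0 Q = P"
    unfolding dyadic_parent_def using ex1_dyadic_parent[OF Q0 _ Q] *(2) by (intro the1_equality) auto
  with * Q show "Q \<in> dyadic_avoiding E Q0"
    unfolding dyadic_avoiding_def by (auto intro!: exI[of _ "Suc j"])
qed

lemma dyadic_avoidingE:
  assumes "is_cube Q0" "Q \<in> dyadic_avoiding E Q0"
  obtains j P where "P \<in> dyadic j Q0" "P \<inter> closure E \<noteq> {}" "Q \<in> dyadic 1 P" "Q \<in> dyadic (Suc j) Q0"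
    "Q \<inter> closure E = {}" "Q \<subseteq> P" "P \<subseteq> Q0" "is_cube P" "is_cube Q"
proof -
  obtain j P where *: "P \<in> dyadic j Q0" "P \<inter> closure E \<noteq> {}" "Q \<in> dyadic 1 P" "Q \<inter> closure E = {}"
    using assms by (auto simp: dyadic_avoiding_iff)
  show thesis
    using * dyadic_trans[OF *(3,1)] is_cube_dyadic[OF *(1)] is_cube_dyadic[OF *(3)]
      dyadic_subset[OF assms(1) *(1)] dyadic_subset[OF _ *(3)]
    by (intro that[of P j]) auto
qed

lemma countable_dyadic_avoiding: "is_cube Q0 \<Longrightarrow> countable (dyadic_avoiding E Q0)"
proof -
  assume "is_cube Q0"
  then have "countable (\<Union>j. dyadic j Q0)"
    by (intro countable_UN) (auto simp: finite_dyadic countable_finite)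
  then show ?thesis
    by (rule countable_subset[rotated]) (auto simp: dyadic_avoiding_def)
qed

lemma sets_dyadic_avoiding: "is_cube Q0 \<Longrightarrow> dyadic_avoiding E Q0 \<subseteq> sets lebesgue"
  by (auto intro: is_cube_sets elim: dyadic_avoidingE)

text \<open>If \<open>R\<close> were at least as large as the parent of \<open>Q\<close>, it would
  contain that parent and hence meet the closure of \<open>E\<close>. So \<open>R\<close> is at most
  as large as \<open>Q\<close>, and the two share a point.\<close>

lemma dyadic_avoiding_level_unique:
  assumes Q0: "is_cube Q0" and Q: "Q \<in> dyadic_avoiding E Q0" and R: "R \<in> dyadic i Q0" "R \<inter> closure E = {}"
    and x: "x \<in> Q" "x \<in> R"
  shows "R \<subseteq> Q"
proof -
  obtain j P where P: "P \<in> dyadic j Q0" "P \<inter> closure E \<noteq> {}" "Q \<in> dyadic (Suc j) Q0" "Q \<subseteq> P"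
    using dyadic_avoidingE[OF Q0 Q] by metis
  have "\<not> i \<le> j"
    using dyadic_nested(2)[OF Q0 R(1) P(1)] P x R(2) by blast
  then show ?thesis
    using dyadic_nested(2)[OF Q0 P(3) R(1)] x by auto
qed

lemma disjoint_dyadic_avoiding:
  assumes Q0: "is_cube Q0"
  shows "disjoint (dyadic_avoiding E Q0)"
proof (rule disjointI)
  fix P Q assume PQ: "P \<in> dyadic_avoiding E Q0" "Q \<in> dyadic_avoiding E Q0" "P \<noteq> Q"
  show "P \<inter> Q = {}"
  proof (rule ccontr)
    assume "P \<inter> Q \<noteq> {}"
    then obtain x where x: "x \<in> P" "x \<in> Q" by blast
    obtain i where i: "P \<in> dyadic i Q0" "P \<inter> closure E = {}"
      by (rule dyadic_avoidingE[OF Q0 PQ(1)])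
    obtain j where j: "Q \<in> dyadic j Q0" "Q \<inter> closure E = {}"
      by (rule dyadic_avoidingE[OF Q0 PQ(2)])
    have "Q \<subseteq> P"
      by (rule dyadic_avoiding_level_unique[OF Q0 PQ(1) j x])
    moreover have "P \<subseteq> Q"
      by (rule dyadic_avoiding_level_unique[OF Q0 PQ(2) i x(2,1)])
    ultimately show False using PQ(3) by blast
  qed
qed

text \<open>Maximality is a condition on the immediate parent, and a parent inside \<open>R\<close>
  is also a dyadic cube of \<open>Q0\<close>.\<close>

lemma dyadic_avoiding_subset:
  assumes "is_cube Q0" "R \<in> dyadic j Q0"
  shows "dyadic_avoiding E R \<subseteq> dyadic_avoiding E Q0"
proof
  fix Q assume Q: "Q \<in> dyadic_avoiding E R"
  obtain i P where P: "P \<in> dyadic i R" "P \<inter> closure E \<noteq> {}" "Q \<in> dyadic 1 P" "Q \<inter> closure E = {}"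
    by (rule dyadic_avoidingE[OF is_cube_dyadic[OF assms(2)] Q])
  have "P \<in> dyadic (i + j) Q0"
    by (rule dyadic_trans[OF P(1) assms(2)])
  with P show "Q \<in> dyadic_avoiding E Q0"
    unfolding dyadic_avoiding_iff[OF assms(1)] by auto
qed

lemma dist_cube_le:
  fixes x y :: "real ^ 'n" and l :: real
  assumes "x \<in> cube a l" "y \<in> cube a l"
  shows "dist x y \<le> CARD('n) * l"
proof -
  have "dist x y \<le> (\<Sum>i\<in>UNIV. \<bar>(x - y) $ i\<bar>)"
    unfolding dist_norm by (rule norm_le_l1_cart)
  also have "\<dots> \<le> (\<Sum>i\<in>(UNIV :: 'n set). l)"
  proof (rule sum_mono)
    fix i
    have "a $ i \<le> x $ i" "x $ i < a $ i + l" "a $ i \<le> y $ i" "y $ i < a $ i + l"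
      using assms by (auto simp: cube_def)
    then show "\<bar>(x - y) $ i\<bar> \<le> l" by simp
  qed
  finally show ?thesis by simp
qed

lemma dist_is_cube_le:
  fixes x y :: "real ^ 'n"
  assumes "is_cube Q" "x \<in> Q" "y \<in> Q"
  shows "dist x y \<le> CARD('n) * side Q"
  using assms dist_cube_le[of x _ _ y] by (auto simp: is_cube_def side_cube)

lemma dyadic_small:
  fixes Q0 :: "(real ^ 'n) set"
  assumes Q0: "is_cube Q0" and x: "x \<in> Q0" and xU: "x \<notin> closure E"
  obtains j R where "R \<in> dyadic j Q0" "x \<in> R" "R \<inter> closure E = {}"
proof -
  have "open (- closure E)" by (simp add: open_Compl)
  then obtain e where e: "0 < e" "ball x e \<subseteq> - closure E"
    using xU open_contains_ball by blast
  obtain j where j: "CARD('n) * side Q0 / e < 2 ^ j"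
    using real_arch_pow[of 2] by auto
  obtain R where R: "R \<in> dyadic j Q0" "x \<in> R"
    using Union_dyadic[OF Q0, of j] x by blast
  have "CARD('n) * side R < e"
    using j e(1) by (simp add: side_dyadic[OF R(1)] field_simps)
  then have "R \<subseteq> ball x e"
    using dist_is_cube_le[OF is_cube_dyadic[OF R(1)] R(2)] by force
  with e R that show thesis by blast
qed

lemma Union_dyadic_avoiding:
  fixes Q0 :: "(real ^ 'n) set"
  assumes Q0: "is_cube Q0" and ne: "Q0 \<inter> closure E \<noteq> {}"
  shows "\<Union>(dyadic_avoiding E Q0) = Q0 - closure E"
proof
  show "\<Union>(dyadic_avoiding E Q0) \<subseteq> Q0 - closure E"
  proof (rule Union_least)
    fix Q assume "Q \<in> dyadic_avoiding E Q0"
    then show "Q \<subseteq> Q0 - closure E"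
      by (rule dyadic_avoidingE[OF Q0]) blast
  qed
  show "Q0 - closure E \<subseteq> \<Union>(dyadic_avoiding E Q0)"
  proof
    fix x assume x: "x \<in> Q0 - closure E"
    let ?P = "\<lambda>j. \<exists>R\<in>dyadic j Q0. x \<in> R \<and> R \<inter> closure E = {}"
    define j where "j = (LEAST j. ?P j)"
    have "\<exists>j. ?P j"
      using dyadic_small[OF Q0, of x] x by (metis Diff_iff)
    then have j: "?P j" unfolding j_def by (rule LeastI_ex)
    then obtain R where R: "R \<in> dyadic j Q0" "x \<in> R" "R \<inter> closure E = {}" by blast
    \<comment> \<open>Level 0 is \<open>Q0\<close> itself, which meets the closure; so the first
      avoiding cube through \<open>x\<close> has a parent.\<close>
    have "j \<noteq> 0" using R ne by (auto simp: dyadic_0[OF Q0])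
    then obtain i where i: "j = Suc i" by (cases j) auto
    obtain P where P: "P \<in> dyadic i Q0" "x \<in> P"
      using Union_dyadic[OF Q0, of i] x by blast
    have "\<not> ?P i" using not_less_Least[of i ?P] i unfolding j_def by auto
    with P have "P \<inter> closure E \<noteq> {}" by blast
    moreover have "R \<in> dyadic 1 P"
      using dyadic_nested(1)[OF Q0 P(1) R(1) _ P(2) R(2)] i by simp
    ultimately have "R \<in> dyadic_avoiding E Q0"
      using R P by (auto simp: dyadic_avoiding_iff[OF Q0])
    with R show "x \<in> \<Union>(dyadic_avoiding E Q0)" by blast
  qed
qed

section \<open>The John-Nirenberg argument on dyadic cubes\<close>

text \<open>The bound \<open>s < 1/3\<close> gives \<open>s / (1 - s) \<le> 1/2\<close>. Cancelling
  the finite positive factor \<open>1 - s\<close> is legitimate in \<open>ennreal\<close> even for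
  infinite \<open>A\<close> and \<open>B\<close>.\<close>

lemma ennreal_cancel_half:
  assumes "ennreal (1 - s) * A \<le> ennreal s * B" "0 \<le> s" "s < 1/3"
  shows "A \<le> ennreal (1/2) * B"
proof -
  have "ennreal (1 - s) * A \<le> ennreal ((1 - s) * (1/2)) * B"
    using assms by (elim order_trans, intro mult_right_mono ennreal_leI) auto
  also have "\<dots> = ennreal (1 - s) * (ennreal (1/2) * B)"
    using assms by (subst ennreal_mult) (auto simp: mult.assoc)
  finally show ?thesis
    using assms by (subst (asm) ennreal_mult_le_mult_iff) auto
qed

text \<open>If \<open>u < v\<close>, each point of \<open>R\<close> outside \<open>Z\<close> has
  \<open>g < v\<close> or \<open>u < g\<close>, so the two exceptional sets cover \<open>R\<close>
  up to a null set. Their total measure is at most \<open>s * (1 + 2 ^ n)\<close> times that of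
  \<open>R\<close>, which is too small. The lemma serves both for a child \<open>R\<close> of
  \<open>Q\<close> and for \<open>R = Q\<close>.\<close>

lemma dyadic_median_le:
  fixes Q R :: "(real ^ 'n) set"
  assumes cubes: "is_cube Q" "is_cube R" "R \<subseteq> Q" "emeasure lebesgue Q \<le> 2 ^ CARD('n) * emeasure lebesgue R"
    and Z: "Z \<in> null_sets lebesgue" and g[measurable]: "g \<in> borel_measurable lebesgue"
    and s: "0 \<le> s" "s * (1 + 2 ^ CARD('n)) < 1"
    and upper: "emeasure lebesgue {x \<in> Q - Z. u < g x} \<le> ennreal s * emeasure lebesgue Q"
    and lower: "emeasure lebesgue {x \<in> R - Z. g x < v} \<le> ennreal s * emeasure lebesgue R"
  shows "v \<le> (u :: real)"
proof (rule ccontr)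
  assume uv: "\<not> v \<le> u"
  have [measurable]: "Z \<in> sets lebesgue" "Q \<in> sets lebesgue" "R \<in> sets lebesgue"
    using Z cubes is_cube_sets by auto
  define m where "m = side R ^ CARD('n)"
  have m: "0 < m" "emeasure lebesgue R = ennreal m"
    using emeasure_is_cube[OF cubes(2)] side_pos[OF cubes(2)] by (auto simp: m_def)
  let ?A = "{x \<in> R - Z. g x < v}" and ?B = "{x \<in> Q - Z. u < g x}"
  have "R \<subseteq> Z \<union> (?A \<union> ?B)"
    using uv cubes(3) by (auto simp: not_le)
  then have "emeasure lebesgue R \<le> emeasure lebesgue (Z \<union> (?A \<union> ?B))"
    by (rule emeasure_mono) measurable
  also have "\<dots> = emeasure lebesgue (?A \<union> ?B)"
    by (rule emeasure_Un_null_set[OF _ Z, of "?A \<union> ?B", unfolded Un_commute[of _ Z]]) measurable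
  also have "\<dots> \<le> emeasure lebesgue ?A + emeasure lebesgue ?B"
    by (rule emeasure_subadditive) measurable
  also have "\<dots> \<le> ennreal s * emeasure lebesgue R + ennreal s * (2 ^ CARD('n) * emeasure lebesgue R)"
    using upper lower cubes(4) by (intro add_mono) (auto elim!: order_trans intro: mult_left_mono)
  also have "\<dots> = ennreal (s * (1 + 2 ^ CARD('n)) * m)"
  proof -
    have "(2 :: ennreal) ^ CARD('n) = ennreal (2 ^ CARD('n))"
      by (simp add: ennreal_power[symmetric])
    then show ?thesis
      using s(1) m(1)
      by (simp add: m(2) ennreal_plus[symmetric] ennreal_mult[symmetric] algebra_simps del: ennreal_plus)
  qed
  also have "\<dots> < ennreal m"
    using m(1) s by (intro ennreal_lessI) auto
  finally show False using m(2) by simp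
qed

text \<open>Stopping at the maximal cubes with \<open>b Q < a R\<close>: on more than a fraction \<open>1 - s\<close> of each of them
  \<open>g\<close> exceeds \<open>b Q\<close>, so that together they cover at most the fraction \<open>s / (1 - s) \<le> 1 / 2\<close> of \<open>Q\<close>.\<close>

lemma dyadic_John_Nirenberg:
  fixes Q0 :: "(real ^ 'n) set" and g :: "real ^ 'n \<Rightarrow> real"
  assumes Q0: "is_cube Q0" and Z: "Z \<in> null_sets lebesgue" and g[measurable]: "g \<in> borel_measurable lebesgue"
    and s: "0 \<le> s" "s * (1 + 2 ^ CARD('n)) < 1"
    and upper: "\<And>j R. R \<in> dyadic j Q0 \<Longrightarrow>
      emeasure lebesgue {x \<in> R - Z. b R < g x} \<le> ennreal s * emeasure lebesgue R"
    and lower: "\<And>j R. R \<in> dyadic j Q0 \<Longrightarrow>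
      emeasure lebesgue {x \<in> R - Z. g x < a R} \<le> ennreal s * emeasure lebesgue R"
    and ba: "\<And>j R. R \<in> dyadic j Q0 \<Longrightarrow> b R \<le> a R + c" and c: "0 \<le> c"
    and cover: "\<And>j R x. R \<in> dyadic j Q0 \<Longrightarrow> x \<in> R - Z \<Longrightarrow> \<exists>i. \<exists>S\<in>dyadic i R. x \<in> S \<and> g x \<le> a S"
    and "Q \<in> dyadic j Q0"
  shows "emeasure lebesgue {x \<in> Q - Z. b Q + 2 * c * real k < g x} \<le> ennreal ((1/2) ^ k) * emeasure lebesgue Q"
  using \<open>Q \<in> dyadic j Q0\<close>
proof (induction k arbitrary: Q j)
  case 0
  have "emeasure lebesgue {x \<in> Q - Z. b Q < g x} \<le> emeasure lebesgue Q"
    using is_cube_dyadic[OF 0] by (intro emeasure_mono is_cube_sets) auto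
  then show ?case by simp
next
  case (Suc k)
  have [measurable]: "Z \<in> sets lebesgue" using Z by auto
  have Q: "is_cube Q" using Suc.prems by (rule is_cube_dyadic)
  have tree: "R \<in> dyadic (i + j) Q0" "is_cube R" "R \<subseteq> Q" "R \<in> sets lebesgue" if "R \<in> dyadic i Q" for R i
    using dyadic_trans[OF that Suc.prems] is_cube_dyadic[OF that] dyadic_subset[OF Q that] is_cube_sets by auto
  define F where "F = {R. \<exists>i. R \<in> dyadic i Q \<and> b Q < a R \<and> (\<forall>i'<i. \<forall>P\<in>dyadic i' Q. R \<subseteq> P \<longrightarrow> a P \<le> b Q)}"
  have F_tree: "\<exists>i. R \<in> dyadic i Q" if "R \<in> F" for R
    using that by (auto simp: F_def)
  have F_sets: "R \<in> sets lebesgue" if "R \<in> F" for R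
    using F_tree[OF that] tree(4) by blast
  have F_count: "countable F"
  proof (rule countable_subset)
    show "F \<subseteq> (\<Union>i. dyadic i Q)" using F_tree by blast
    show "countable (\<Union>i. dyadic i Q)"
      using finite_dyadic[OF Q] by (intro countable_UN) (auto simp: countable_finite)
  qed
  have F_disjoint: "R = S" if RS: "R \<in> F" "S \<in> F" and x: "x \<in> R" "x \<in> S" for R S x
  proof -
    have wlog: "R = S" if "R \<in> dyadic i Q" "S \<in> dyadic i' Q" "i \<le> i'" "b Q < a R"
      "\<forall>i''<i'. \<forall>P\<in>dyadic i'' Q. S \<subseteq> P \<longrightarrow> a P \<le> b Q" "x \<in> R" "x \<in> S" for R S i i'
    proof (cases "i = i'")
      case True
      then show ?thesis
        using disjoint_dyadic[OF Q, of i] that unfolding disjoint_def by blast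
    next
      case False
      with that(3) have "i < i'" by simp
      with that(5,1) dyadic_nested(2)[OF Q that(1,2,3,6,7)] have "a R \<le> b Q" by blast
      with that(4) show ?thesis by simp
    qed
    obtain i where i: "R \<in> dyadic i Q" "b Q < a R" "\<forall>i'<i. \<forall>P\<in>dyadic i' Q. R \<subseteq> P \<longrightarrow> a P \<le> b Q"
      using RS(1) by (auto simp: F_def)
    obtain i' where i': "S \<in> dyadic i' Q" "b Q < a S" "\<forall>i<i'. \<forall>P\<in>dyadic i Q. S \<subseteq> P \<longrightarrow> a P \<le> b Q"
      using RS(2) by (auto simp: F_def)
    show ?thesis
    proof (cases "i \<le> i'")
      case True
      show ?thesis by (rule wlog[OF i(1) i'(1) True i(2) i'(3) x])
    next
      case False
      then have "i' \<le> i" by simp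
      show ?thesis by (rule wlog[OF i'(1) i(1) \<open>i' \<le> i\<close> i'(2) i(3) x(2,1), symmetric])
    qed
  qed
  \<comment> \<open>The parent \<open>P\<close> of a stopping cube was not stopped, so
    \<open>a P \<le> b Q\<close>. One \<open>c\<close> leads from \<open>a P\<close> to
    \<open>b P\<close>, the median comparison gives \<open>a R \<le> b P\<close>, and a second
    \<open>c\<close> leads from \<open>a R\<close> to \<open>b R\<close>.\<close>
  have F_b: "b R \<le> b Q + 2 * c" if "R \<in> F" for R
  proof -
    obtain i where i: "R \<in> dyadic i Q" "b Q < a R" "\<forall>i'<i. \<forall>P\<in>dyadic i' Q. R \<subseteq> P \<longrightarrow> a P \<le> b Q"
      using \<open>R \<in> F\<close> by (auto simp: F_def)
    have "i \<noteq> 0"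
    proof
      assume "i = 0"
      then have "R = Q" using i(1) dyadic_0[OF Q] by simp
      moreover have "a Q \<le> b Q"
      proof (rule dyadic_median_le[OF Q Q subset_refl _ Z g s upper[OF Suc.prems] lower[OF Suc.prems]])
        show "emeasure lebesgue Q \<le> 2 ^ CARD('n) * emeasure lebesgue Q"
          using mult_right_mono[of 1 "2 ^ CARD('n) :: ennreal" "emeasure lebesgue Q"] by simp
      qed
      ultimately show False using i(2) by simp
    qed
    then obtain i0 where i0: "i = Suc i0" by (cases i) auto
    obtain x where x: "x \<in> R" using is_cube_nonempty[OF tree(2)[OF i(1)]] by blast
    then obtain P where P: "P \<in> dyadic i0 Q" "x \<in> P"
      using Union_dyadic[OF Q, of i0] tree(3)[OF i(1)] by blast
    have R: "R \<in> dyadic 1 P" "R \<subseteq> P"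
      using dyadic_nested[OF Q P(1) i(1) _ P(2) x] i0 by auto
    have "a P \<le> b Q"
      using i(3) P R i0 by blast
    moreover have "a R \<le> b P"
      using emeasure_dyadic[OF is_cube_dyadic[OF P(1)] R(1)]
      by (intro dyadic_median_le[OF is_cube_dyadic[OF P(1)] tree(2)[OF i(1)] R(2) _ Z g s
          upper[OF tree(1)[OF P(1)]] lower[OF tree(1)[OF i(1)]]]) simp
    ultimately show ?thesis
      using ba[OF tree(1)[OF P(1)]] ba[OF tree(1)[OF i(1)]] by simp
  qed
  \<comment> \<open>The assumption \<open>cover\<close> stands in for a differentiation theorem:
    some cube through \<open>x\<close> has \<open>g x \<le> a S\<close>, so the stopping condition
    is met there, and the least level at which it is met gives a member of \<open>F\<close>.\<close>
  have F_cover: "\<exists>R\<in>F. x \<in> R" if x: "x \<in> Q - Z" "b Q < g x" for x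
  proof -
    let ?P = "\<lambda>i. \<exists>S\<in>dyadic i Q. x \<in> S \<and> b Q < a S"
    define i where "i = (LEAST i. ?P i)"
    have "\<exists>i. ?P i"
      using cover[OF Suc.prems x(1)] x(2) by (meson order_less_le_trans)
    then have "?P i" unfolding i_def by (rule LeastI_ex)
    then obtain S where S: "S \<in> dyadic i Q" "x \<in> S" "b Q < a S" by blast
    have "\<not> ?P i'" if "i' < i" for i'
      using that not_less_Least[of i' ?P] unfolding i_def by blast
    then have "S \<in> F"
      using S by (auto simp: F_def not_less)
    with S show ?thesis by blast
  qed
  let ?X = "\<lambda>R. {x \<in> R - Z. b Q < g x}"
  have sum: "(\<integral>\<^sup>+R. emeasure lebesgue R \<partial>count_space F) \<le> ennreal (1/2) * emeasure lebesgue Q"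
  proof (rule ennreal_cancel_half)
    have X_ge: "ennreal (1 - s) * emeasure lebesgue R \<le> emeasure lebesgue (?X R)" if "R \<in> F" for R
    proof -
      obtain i where i: "R \<in> dyadic i Q" "b Q < a R" using \<open>R \<in> F\<close> by (auto simp: F_def)
      note [measurable] = tree(4)[OF i(1)]
      let ?A = "{x \<in> R - Z. g x < a R}"
      define m where "m = side R ^ CARD('n)"
      have m: "0 < m" "emeasure lebesgue R = ennreal m"
        using emeasure_is_cube[OF tree(2)[OF i(1)]] side_pos[OF tree(2)[OF i(1)]] by (auto simp: m_def)
      have "R \<subseteq> Z \<union> (?X R \<union> ?A)" using i(2) by (auto simp: not_less)
      then have "emeasure lebesgue R \<le> emeasure lebesgue (Z \<union> (?X R \<union> ?A))"
        by (rule emeasure_mono) measurable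
      also have "\<dots> = emeasure lebesgue (?X R \<union> ?A)"
        by (rule emeasure_Un_null_set[OF _ Z, of "?X R \<union> ?A", unfolded Un_commute[of _ Z]]) measurable
      also have "\<dots> \<le> emeasure lebesgue (?X R) + emeasure lebesgue ?A"
        by (rule emeasure_subadditive) measurable
      also have "\<dots> \<le> emeasure lebesgue (?X R) + ennreal (s * m)"
        using lower[OF tree(1)[OF i(1)]] m s(1) by (intro add_mono) (auto simp: ennreal_mult)
      finally have "ennreal m - ennreal (s * m) \<le> emeasure lebesgue (?X R)"
        unfolding m(2) by (subst ennreal_minus_le_iff) (simp add: add.commute)
      moreover have "ennreal m - ennreal (s * m) = ennreal (1 - s) * ennreal m"
      proof -
        have "s * 1 \<le> s * (1 + 2 ^ CARD('n))" using s(1) by (intro mult_left_mono) auto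
        then have "s < 1" using s(2) by linarith
        then show ?thesis
          using m(1) s(1) by (simp add: ennreal_minus ennreal_mult[symmetric] algebra_simps)
      qed
      ultimately show ?thesis using m(2) by simp
    qed
    have "ennreal (1 - s) * (\<integral>\<^sup>+R. emeasure lebesgue R \<partial>count_space F)
        = (\<integral>\<^sup>+R. ennreal (1 - s) * emeasure lebesgue R \<partial>count_space F)"
      by (rule nn_integral_cmult[symmetric]) simp
    also have "\<dots> \<le> (\<integral>\<^sup>+R. emeasure lebesgue (?X R) \<partial>count_space F)"
      using X_ge by (intro nn_integral_mono) simp
    also have "\<dots> = emeasure lebesgue (\<Union>R\<in>F. ?X R)"
    proof (rule emeasure_UN_countable[symmetric])
      show "?X R \<in> sets lebesgue" if "R \<in> F" for R
        using F_sets[OF that] by measurable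
      show "disjoint_family_on ?X F"
        using F_disjoint by (fastforce simp: disjoint_family_on_def)
    qed (rule F_count)
    also have "\<dots> \<le> emeasure lebesgue (?X Q)"
    proof (rule emeasure_mono)
      show "(\<Union>R\<in>F. ?X R) \<subseteq> ?X Q" using F_tree tree(3) by blast
      note [measurable] = is_cube_sets[OF Q]
      show "?X Q \<in> sets lebesgue" by measurable
    qed
    also have "\<dots> \<le> ennreal s * emeasure lebesgue Q" by (rule upper[OF Suc.prems])
    finally show "ennreal (1 - s) * (\<integral>\<^sup>+R. emeasure lebesgue R \<partial>count_space F) \<le> ennreal s * emeasure lebesgue Q" .
    \<comment> \<open>The dimension is at least 1, so the threshold on \<open>s\<close> forces
      \<open>3 * s < 1\<close>.\<close>
    have "(2 :: real) ^ 1 \<le> 2 ^ CARD('n)" by (rule power_increasing) (auto simp: Suc_le_eq)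
    then have "s * 3 \<le> s * (1 + 2 ^ CARD('n))" using s(1) by (intro mult_left_mono) auto
    with s show "s < 1 / 3" by simp
  qed (rule s(1))
  let ?Y = "\<lambda>R. {x \<in> R - Z. b R + 2 * c * real k < g x}"
  \<comment> \<open>Passing from \<open>Q\<close> to a stopping cube \<open>R\<close> raises the
    reference level by at most \<open>2 * c\<close>; hence the level for \<open>Suc k\<close> on
    \<open>Q\<close> is at least the level for \<open>k\<close> on \<open>R\<close>, where the
    induction hypothesis applies.\<close>
  have "emeasure lebesgue {x \<in> Q - Z. b Q + 2 * c * real (Suc k) < g x} \<le> emeasure lebesgue (\<Union>R\<in>F. ?Y R)"
  proof (rule emeasure_mono)
    have eq: "2 * c * real (Suc k) = 2 * c + 2 * c * real k" by (simp add: algebra_simps)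
    show "{x \<in> Q - Z. b Q + 2 * c * real (Suc k) < g x} \<subseteq> (\<Union>R\<in>F. ?Y R)"
    proof
      fix x assume x: "x \<in> {x \<in> Q - Z. b Q + 2 * c * real (Suc k) < g x}"
      moreover have "0 \<le> 2 * c * real (Suc k)" using c by simp
      ultimately have "x \<in> Q - Z" "b Q < g x" by auto
      then obtain R where R: "R \<in> F" "x \<in> R" using F_cover by blast
      with x F_b[OF R(1)] eq show "x \<in> (\<Union>R\<in>F. ?Y R)" by auto
    qed
    show "(\<Union>R\<in>F. ?Y R) \<in> sets lebesgue"
    proof (intro sets.countable_UN'' F_count)
      fix R assume "R \<in> F"
      note [measurable] = F_sets[OF this]
      show "?Y R \<in> sets lebesgue" by measurable
    qed
  qed
  also have "\<dots> = (\<integral>\<^sup>+R. emeasure lebesgue (?Y R) \<partial>count_space F)"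
  proof (rule emeasure_UN_countable)
    show "?Y R \<in> sets lebesgue" if "R \<in> F" for R
      using F_sets[OF that] by measurable
    show "disjoint_family_on ?Y F"
      using F_disjoint by (fastforce simp: disjoint_family_on_def)
  qed (rule F_count)
  also have "\<dots> \<le> (\<integral>\<^sup>+R. ennreal ((1/2) ^ k) * emeasure lebesgue R \<partial>count_space F)"
  proof (rule nn_integral_mono)
    fix R assume "R \<in> space (count_space F)"
    then obtain i where "R \<in> dyadic i Q" using F_tree by auto
    then show "emeasure lebesgue (?Y R) \<le> ennreal ((1/2) ^ k) * emeasure lebesgue R"
      by (rule Suc.IH[OF tree(1)])
  qed
  also have "\<dots> = ennreal ((1/2) ^ k) * (\<integral>\<^sup>+R. emeasure lebesgue R \<partial>count_space F)"
    by (rule nn_integral_cmult) simp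
  also have "\<dots> \<le> ennreal ((1/2) ^ k) * (ennreal (1/2) * emeasure lebesgue Q)"
    by (intro mult_left_mono sum) simp
  also have "\<dots> = ennreal ((1/2) ^ k * (1/2)) * emeasure lebesgue Q"
    by (subst ennreal_mult) (simp_all only: mult.assoc zero_le_power zero_le_divide_1_iff zero_le_numeral)
  also have "(1/2) ^ k * (1/2) = (1/2 :: real) ^ Suc k"
    by simp
  finally show ?case .
qed

section \<open>Exponential integrability from geometric tails\<close>

text \<open>A discrete layer-cake bound: with \<open>q = exp (\<gamma> * c)\<close>, the function
  \<open>exp (\<gamma> * h)\<close> is at most 1 plus the sum of \<open>q ^ Suc k\<close> over all
  \<open>k\<close> with \<open>c * k < h\<close>. Integration leaves a geometric series of ratio
  \<open>q * \<eta>\<close>, and \<open>small\<close> is its convergence.\<close>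

lemma nn_integral_exp_le_of_tail:
  fixes h :: "'a \<Rightarrow> real"
  assumes [measurable]: "A \<in> sets M" "h \<in> borel_measurable M"
    and pos: "0 < c" "0 \<le> \<gamma>" "0 \<le> \<eta>" "0 \<le> K" "0 \<le> m" and small: "exp (\<gamma> * c) * \<eta> < 1"
    and A: "emeasure M A \<le> ennreal m"
    and tail: "\<And>k. emeasure M {x \<in> A. c * real k < h x} \<le> ennreal (K * \<eta> ^ k * m)"
  shows "(\<integral>\<^sup>+x\<in>A. ennreal (exp (\<gamma> * h x)) \<partial>M)
    \<le> ennreal ((1 + K * exp (\<gamma> * c) / (1 - exp (\<gamma> * c) * \<eta>)) * m)"
proof -
  let ?S = "\<lambda>k. {x \<in> A. c * real k < h x}"
  define q where "q = exp (\<gamma> * c)"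
  have le: "ennreal (exp (\<gamma> * h x)) * indicator A x
      \<le> indicator A x + (\<Sum>k. ennreal (q ^ Suc k) * indicator (?S k) x)" for x
  proof (cases "x \<in> A")
    case True
    show ?thesis
    proof (cases "h x \<le> 0")
      case True
      then have "exp (\<gamma> * h x) \<le> 1" using pos(2) by (simp add: mult_nonneg_nonpos)
      then have "ennreal (exp (\<gamma> * h x)) \<le> 1" by (simp add: ennreal_le_1)
      with \<open>x \<in> A\<close> show ?thesis by (simp add: add_increasing2)
    next
      case False
      \<comment> \<open>The largest index with \<open>c * k < h x\<close>; its single summand
        already dominates. The inequality in the tails is strict, so the ceiling is lowered by one
        instead of taking the floor.\<close>
      define k where "k = nat (\<lceil>h x / c\<rceil> - 1)"
      have "0 < h x / c" using False pos(1) by simp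
      then have "0 < \<lceil>h x / c\<rceil>" by linarith
      then have "int k = \<lceil>h x / c\<rceil> - 1" by (simp add: k_def)
      then have "real k = of_int \<lceil>h x / c\<rceil> - 1" by linarith
      then have "real k < h x / c" "h x / c \<le> real (Suc k)" by linarith+
      then have k: "c * real k < h x" "h x \<le> c * real (Suc k)"
        using pos(1) by (simp_all add: field_simps)
      have "exp (\<gamma> * h x) \<le> exp (real (Suc k) * (\<gamma> * c))"
        using mult_left_mono[OF k(2) pos(2)] by (simp add: mult_ac del: of_nat_Suc)
      also have "\<dots> = q ^ Suc k"
        by (simp add: q_def exp_of_nat_mult del: of_nat_Suc power_Suc)
      finally have "ennreal (exp (\<gamma> * h x)) * indicator A x \<le> ennreal (q ^ Suc k) * indicator (?S k) x"
        using True k(1) by (simp add: ennreal_leI del: power_Suc)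
      also have "\<dots> \<le> (\<Sum>k. ennreal (q ^ Suc k) * indicator (?S k) x)"
      proof -
        have "f k \<le> suminf f" for f :: "nat \<Rightarrow> ennreal"
          using sum_le_suminf[of f "{k}"] by simp
        from this[of "\<lambda>k. ennreal (q ^ Suc k) * indicator (?S k) x"] show ?thesis .
      qed
      finally show ?thesis by (rule add_increasing[rotated]) simp
    qed
  qed simp
  have "(\<integral>\<^sup>+x\<in>A. ennreal (exp (\<gamma> * h x)) \<partial>M)
      \<le> (\<integral>\<^sup>+x. indicator A x + (\<Sum>k. ennreal (q ^ Suc k) * indicator (?S k) x) \<partial>M)"
    using le by (intro nn_integral_mono) auto
  also have "\<dots> = emeasure M A + (\<Sum>k. \<integral>\<^sup>+x. ennreal (q ^ Suc k) * indicator (?S k) x \<partial>M)"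
    by (subst nn_integral_add) (simp_all add: nn_integral_suminf del: power_Suc)
  also have "\<dots> = emeasure M A + (\<Sum>k. ennreal (q ^ Suc k) * emeasure M (?S k))"
    by (simp add: nn_integral_cmult_indicator del: power_Suc)
  also have "\<dots> \<le> ennreal m + (\<Sum>k. ennreal ((K * q * m) * (q * \<eta>) ^ k))"
  proof (intro add_mono A suminf_le)
    fix k
    have "ennreal (q ^ Suc k) * emeasure M (?S k) \<le> ennreal (q ^ Suc k) * ennreal (K * \<eta> ^ k * m)"
      by (intro mult_left_mono tail) simp
    also have "\<dots> = ennreal ((K * q * m) * (q * \<eta>) ^ k)"
      using pos by (subst ennreal_mult[symmetric]) (auto simp: q_def power_mult_distrib mult_ac)
    finally show "ennreal (q ^ Suc k) * emeasure M (?S k) \<le> ennreal ((K * q * m) * (q * \<eta>) ^ k)" .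
  qed auto
  also have "(\<Sum>k. ennreal ((K * q * m) * (q * \<eta>) ^ k)) = ennreal ((K * q * m) * (1 / (1 - q * \<eta>)))"
    using pos small
    by (intro suminf_ennreal_eq sums_mult geometric_sums) (auto simp: q_def)
  also have "ennreal m + \<dots> = ennreal (m + (K * q * m) * (1 / (1 - q * \<eta>)))"
    using pos small by (subst ennreal_plus) (auto simp: q_def)
  also have "m + (K * q * m) * (1 / (1 - q * \<eta>)) = (1 + K * exp (\<gamma> * c) / (1 - exp (\<gamma> * c) * \<eta>)) * m"
    by (simp add: q_def algebra_simps add_divide_distrib diff_divide_distrib)
  finally show ?thesis .
qed

section \<open>The dyadic distance\<close>

text \<open>The function \<open>f\<close> of the overview. The value is 0 off the avoiding cubes, in
  particular on the closure of \<open>E\<close>. If \<open>Q0\<close> misses that closure, no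
  subcube has a parent meeting it and the function vanishes identically.\<close>

definition dyadic_dist :: "(real ^ 'n) set \<Rightarrow> (real ^ 'n) set \<Rightarrow> real ^ 'n \<Rightarrow> real" where
  "dyadic_dist E Q0 x =
    (if \<exists>Q\<in>dyadic_avoiding E Q0. x \<in> Q then side (THE Q. Q \<in> dyadic_avoiding E Q0 \<and> x \<in> Q) else 0)"

lemma dyadic_dist_eq:
  assumes "is_cube Q0" "Q \<in> dyadic_avoiding E Q0" "x \<in> Q"
  shows "dyadic_dist E Q0 x = side Q"
proof -
  have "(THE Q. Q \<in> dyadic_avoiding E Q0 \<and> x \<in> Q) = Q"
    using disjoint_dyadic_avoiding[OF assms(1), of E] assms(2,3)
    by (intro the_equality) (auto simp: disjoint_def)
  then show ?thesis
    using assms(2,3) by (auto simp: dyadic_dist_def)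
qed

lemma dyadic_avoiding_is_cube: "is_cube Q0 \<Longrightarrow> Q \<in> dyadic_avoiding E Q0 \<Longrightarrow> is_cube Q"
  by (erule dyadic_avoidingE)

lemma dyadic_dist_measurable [measurable]:
  assumes "is_cube Q0"
  shows "dyadic_dist E Q0 \<in> borel_measurable lebesgue"
  unfolding borel_measurable_iff_greater
proof
  fix t
  let ?D = "dyadic_avoiding E Q0"
  have un: "\<Union>A \<in> sets lebesgue" if "A \<subseteq> ?D" for A
    using that sets_dyadic_avoiding[OF assms, of E] countable_subset[OF that countable_dyadic_avoiding[OF assms]]
    by (intro sets.countable_Union) auto
  \<comment> \<open>For \<open>t < 0\<close> the default value 0 puts everything outside the
    avoiding cubes into the superlevel set.\<close>
  have "{x \<in> space lebesgue. t < dyadic_dist E Q0 x} = \<Union>{Q \<in> ?D. t < side Q} \<union> (if t < 0 then - \<Union>?D else {})"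
  proof (rule set_eqI)
    fix x
    show "x \<in> {x \<in> space lebesgue. t < dyadic_dist E Q0 x} \<longleftrightarrow>
      x \<in> \<Union>{Q \<in> ?D. t < side Q} \<union> (if t < 0 then - \<Union>?D else {})"
    proof (cases "\<exists>Q\<in>?D. x \<in> Q")
      case True
      then obtain Q where Q: "Q \<in> ?D" "x \<in> Q" by blast
      have "Q' = Q" if "Q' \<in> ?D" "x \<in> Q'" for Q'
        using disjoint_dyadic_avoiding[OF assms, of E] that Q by (auto simp: disjoint_def)
      then have "x \<in> \<Union>{Q \<in> ?D. t < side Q} \<longleftrightarrow> t < side Q"
        using Q by blast
      moreover have "x \<notin> (if t < 0 then - \<Union>?D else {})"
        using Q by auto
      ultimately show ?thesis
        using dyadic_dist_eq[OF assms Q] by simp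
    next
      case False
      then have "dyadic_dist E Q0 x = 0" by (auto simp: dyadic_dist_def)
      moreover have "x \<notin> \<Union>{Q \<in> ?D. t < side Q}" "x \<in> - \<Union>?D"
        using False by blast+
      ultimately show ?thesis by simp
    qed
  qed
  also have "\<dots> \<in> sets lebesgue"
  proof (rule sets.Un)
    show "\<Union>{Q \<in> ?D. t < side Q} \<in> sets lebesgue" by (rule un) blast
    have "- \<Union>?D \<in> sets lebesgue"
      using sets.compl_sets[OF un[of ?D]] by (simp add: Compl_eq_Diff_UNIV)
    then show "(if t < 0 then - \<Union>?D else {}) \<in> sets lebesgue" by simp
  qed
  finally show "{x \<in> space lebesgue. t < dyadic_dist E Q0 x} \<in> sets lebesgue" .
qed

lemma infdist_measurable_lebesgue [measurable]: "(\<lambda>x. infdist x E) \<in> borel_measurable lebesgue"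
  by (intro measurable_completion) (simp add: borel_measurable_continuous_onI continuous_on_infdist)

lemma dyadic_avoiding_cover:
  fixes Q0 :: "(real ^ 'n) set"
  assumes "is_cube Q0" "Q0 \<inter> closure E \<noteq> {}" "x \<in> Q0 - closure E"
  obtains Q where "Q \<in> dyadic_avoiding E Q0" "x \<in> Q" "dyadic_dist E Q0 x = side Q"
  using Union_dyadic_avoiding[OF assms(1,2)] assms(3) dyadic_dist_eq[OF assms(1)] by blast

lemma dyadic_dist_pos:
  fixes Q0 :: "(real ^ 'n) set"
  assumes "is_cube Q0" "Q0 \<inter> closure E \<noteq> {}" "x \<in> Q0 - closure E"
  shows "0 < dyadic_dist E Q0 x"
  using dyadic_avoiding_cover[OF assms] side_pos dyadic_avoiding_is_cube[OF assms(1)] by metis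

text \<open>The function of the root \<open>Q0\<close> describes the avoiding family of each dyadic
  subcube \<open>R\<close> that meets the closure. The predicate \<open>\<phi>\<close> is abstract
  because the upper scale asks for large sides and the lower scale for small ones.\<close>

lemma Union_dyadic_avoiding_side:
  fixes Q0 R :: "(real ^ 'n) set"
  assumes Q0: "is_cube Q0" and R: "R \<in> dyadic j Q0" "R \<inter> closure E \<noteq> {}"
  shows "\<Union>{Q \<in> dyadic_avoiding E R. \<phi> (side Q)} = {x \<in> R - closure E. \<phi> (dyadic_dist E Q0 x)}"
proof -
  have cR: "is_cube R" by (rule is_cube_dyadic[OF R(1)])
  have eq: "dyadic_dist E Q0 x = side Q" if "Q \<in> dyadic_avoiding E R" "x \<in> Q" for Q x
    using that dyadic_avoiding_subset[OF Q0 R(1)] by (intro dyadic_dist_eq[OF Q0]) auto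
  show ?thesis
    unfolding Union_dyadic_avoiding[OF cR R(2), symmetric]
  proof (intro subset_antisym subsetI)
    fix x assume "x \<in> \<Union>{Q \<in> dyadic_avoiding E R. \<phi> (side Q)}"
    then obtain Q where "Q \<in> dyadic_avoiding E R" "\<phi> (side Q)" "x \<in> Q" by blast
    with eq show "x \<in> {x \<in> \<Union> (dyadic_avoiding E R). \<phi> (dyadic_dist E Q0 x)}" by auto
  next
    fix x assume "x \<in> {x \<in> \<Union> (dyadic_avoiding E R). \<phi> (dyadic_dist E Q0 x)}"
    then obtain Q where "Q \<in> dyadic_avoiding E R" "\<phi> (dyadic_dist E Q0 x)" "x \<in> Q" by blast
    with eq[of Q x] show "x \<in> \<Union>{Q \<in> dyadic_avoiding E R. \<phi> (side Q)}" by auto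
  qed
qed

lemma infsum_dyadic_avoiding:
  fixes Q0 R :: "(real ^ 'n) set"
  assumes Q0: "is_cube Q0" and R: "R \<in> dyadic j Q0" "R \<inter> closure E \<noteq> {}"
  shows "(\<Sum>\<^sub>\<infinity>Q\<in>{Q \<in> dyadic_avoiding E R. \<phi> (side Q)}. emeasure lebesgue Q)
    = emeasure lebesgue {x \<in> R - closure E. \<phi> (dyadic_dist E Q0 x)}"
proof -
  have cR: "is_cube R" by (rule is_cube_dyadic[OF R(1)])
  have "(\<Sum>\<^sub>\<infinity>Q\<in>{Q \<in> dyadic_avoiding E R. \<phi> (side Q)}. emeasure lebesgue Q)
      = emeasure lebesgue (\<Union>{Q \<in> dyadic_avoiding E R. \<phi> (side Q)})"
  proof (rule infsum_emeasure_disjoint)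
    show "countable {Q \<in> dyadic_avoiding E R. \<phi> (side Q)}"
      using countable_dyadic_avoiding[OF cR, of E] by (rule countable_subset[rotated]) auto
    show "disjoint {Q \<in> dyadic_avoiding E R. \<phi> (side Q)}"
      using disjoint_dyadic_avoiding[OF cR, of E] by (auto simp: disjoint_def)
    show "{Q \<in> dyadic_avoiding E R. \<phi> (side Q)} \<subseteq> sets lebesgue"
      using sets_dyadic_avoiding[OF cR, of E] by auto
  qed
  then show ?thesis
    by (simp only: Union_dyadic_avoiding_side[OF assms])
qed

text \<open>A dyadic cube that misses the closure lies inside a single maximal one. This supplies
  the levels of the cubes to which the hypothesis on the scales does not apply.\<close>

lemma dyadic_dist_const:
  fixes Q0 R :: "(real ^ 'n) set"
  assumes Q0: "is_cube Q0" "Q0 \<inter> closure E \<noteq> {}" and R: "R \<in> dyadic j Q0" "R \<inter> closure E = {}" "x \<in> R" "y \<in> R"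
  shows "dyadic_dist E Q0 x = dyadic_dist E Q0 y"
proof -
  have "x \<in> Q0 - closure E" using R dyadic_subset[OF Q0(1) R(1)] by blast
  then obtain Q where Q: "Q \<in> dyadic_avoiding E Q0" "x \<in> Q" "dyadic_dist E Q0 x = side Q"
    by (rule dyadic_avoiding_cover[OF Q0])
  have "y \<in> Q"
    using dyadic_avoiding_level_unique[OF Q0(1) Q(1) R(1,2) Q(2) R(3)] R(4) by blast
  with Q show ?thesis using dyadic_dist_eq[OF Q0(1) Q(1)] by simp
qed

section \<open>Comparison of the distance to \<open>E\<close> with the dyadic distance\<close>

text \<open>The parent of the avoiding cube around \<open>x\<close> contains a point of the closure.
  It has twice the side, and the diameter of a cube is at most \<open>CARD('n)\<close> times its
  side.\<close>

lemma infdist_le_dyadic_dist: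
  fixes Q0 :: "(real ^ 'n) set"
  assumes Q0: "is_cube Q0" "Q0 \<inter> closure E \<noteq> {}" and x: "x \<in> Q0 - closure E"
  shows "infdist x E \<le> 2 * real CARD('n) * dyadic_dist E Q0 x"
proof -
  obtain Q where Q: "Q \<in> dyadic_avoiding E Q0" "x \<in> Q" "dyadic_dist E Q0 x = side Q"
    by (rule dyadic_avoiding_cover[OF Q0 x])
  obtain P where P: "P \<inter> closure E \<noteq> {}" "Q \<in> dyadic 1 P" "Q \<subseteq> P" "is_cube P"
    by (rule dyadic_avoidingE[OF Q0(1) Q(1)])
  obtain e where e: "e \<in> P" "e \<in> closure E" using P(1) by blast
  then have "E \<noteq> {}" by auto
  then have "infdist e E = 0" using e in_closure_iff_infdist_zero by blast
  then have "infdist x E \<le> dist x e" using infdist_triangle[of x E e] by simp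
  also have "\<dots> \<le> CARD('n) * side P"
    using P Q e by (intro dist_is_cube_le) auto
  also have "side P = 2 * side Q" using side_dyadic[OF P(2)] by simp
  finally show ?thesis using Q(3) by simp
qed

text \<open>Since \<open>E\<close> lies outside \<open>Q\<close>, points this close to
  \<open>E\<close> form part of a boundary layer of width \<open>t * side Q\<close>, the complement
  of a concentric cube of side \<open>(1 - 2 * t) * side Q\<close>. Bernoulli's inequality makes the
  bound linear in \<open>t\<close>; for \<open>t > 1/2\<close> the factor on the right is at least
  1.\<close>

lemma emeasure_near_boundary:
  fixes Q E :: "(real ^ 'n) set" and t :: real
  assumes E: "E \<noteq> {}" and Q: "is_cube Q" "Q \<inter> closure E = {}" and t: "0 \<le> t"
  shows "emeasure lebesgue {x \<in> Q. infdist x E < t * side Q} \<le> ennreal (2 * real CARD('n) * t) * emeasure lebesgue Q"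
proof -
  obtain b h where h: "0 < h" and Qb: "Q = cube b h" using Q(1) by (auto simp: is_cube_def)
  have side: "side Q = h" using h by (simp add: Qb side_cube)
  have [measurable]: "Q \<in> sets lebesgue" by (simp add: Qb)
  show ?thesis
  proof (cases "t \<le> 1/2")
    case False
    have "1 * (1 / 2) \<le> real CARD('n) * t"
      using False by (intro mult_mono) (auto simp: Suc_le_eq)
    then have "ennreal 1 \<le> ennreal (2 * real CARD('n) * t)"
      by (intro ennreal_leI) simp
    from mult_right_mono[OF this, of "emeasure lebesgue Q"]
    have "emeasure lebesgue Q \<le> ennreal (2 * real CARD('n) * t) * emeasure lebesgue Q" by simp
    moreover have "emeasure lebesgue {x \<in> Q. infdist x E < t * side Q} \<le> emeasure lebesgue Q"
      by (intro emeasure_mono) auto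
    ultimately show ?thesis by (rule order_trans[rotated])
  next
    case True
    let ?I = "cube (b + (\<chi> i. t * h)) ((1 - 2 * t) * h)"
    have far: "t * h \<le> infdist x E" if x: "x \<in> ?I" for x
    proof -
      have "t * h \<le> dist x y" if y: "y \<in> E" for y
      proof -
        have "y \<notin> cube b h" using Q(2) y closure_subset[of E] by (auto simp: Qb)
        then obtain i where "y $ i < b $ i \<or> b $ i + h \<le> y $ i"
          by (auto simp: cube_def not_le not_less)
        moreover have "b $ i + t * h \<le> x $ i" "x $ i < b $ i + t * h + (1 - 2 * t) * h"
          using x by (auto simp: cube_def)
        ultimately have "t * h \<le> \<bar>(x - y) $ i\<bar>" by (auto simp: algebra_simps)
        also have "\<dots> \<le> dist x y" unfolding dist_norm by (rule component_le_norm_cart)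
        finally show ?thesis .
      qed
      then show ?thesis
        using E by (auto simp: infdist_notempty intro!: cINF_greatest)
    qed
    have sub: "?I \<subseteq> Q"
    proof
      fix x assume x: "x \<in> ?I"
      have "b $ i \<le> x $ i \<and> x $ i < b $ i + h" for i
      proof -
        have "b $ i + t * h \<le> x $ i" "x $ i < b $ i + t * h + (1 - 2 * t) * h"
          using x by (auto simp: cube_def)
        moreover have "0 \<le> t * h" using t h by simp
        ultimately show ?thesis by (simp add: algebra_simps)
      qed
      then show "x \<in> Q" by (simp add: Qb cube_def)
    qed
    have eI: "emeasure lebesgue ?I = ennreal (((1 - 2 * t) * h) ^ CARD('n))"
      using True h by (intro emeasure_cube) simp
    have eQ: "emeasure lebesgue Q = ennreal (h ^ CARD('n))"
      unfolding Qb using h by (intro emeasure_cube) simp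
    have "{x \<in> Q. infdist x E < t * side Q} \<subseteq> Q - ?I"
      using far by (fastforce simp: side)
    then have "emeasure lebesgue {x \<in> Q. infdist x E < t * side Q} \<le> emeasure lebesgue (Q - ?I)"
      by (rule emeasure_mono) (intro sets.Diff, simp_all)
    also have "\<dots> = emeasure lebesgue Q - emeasure lebesgue ?I"
      using sub eI by (intro emeasure_Diff) auto
    also have "\<dots> = ennreal (h ^ CARD('n)) - ennreal (((1 - 2 * t) * h) ^ CARD('n))"
      by (simp only: eI eQ)
    also have "\<dots> = ennreal (h ^ CARD('n) - ((1 - 2 * t) * h) ^ CARD('n))"
      using True h by (intro ennreal_minus) simp
    also have "\<dots> \<le> ennreal (2 * real CARD('n) * t * h ^ CARD('n))"
    proof (rule ennreal_leI)
      have "1 + real CARD('n) * (- 2 * t) \<le> (1 + (- 2 * t)) ^ CARD('n)"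
        using True by (intro Bernoulli_inequality) simp
      then have "(1 - 2 * real CARD('n) * t) * h ^ CARD('n) \<le> (1 - 2 * t) ^ CARD('n) * h ^ CARD('n)"
        using h by (intro mult_right_mono) auto
      then show "h ^ CARD('n) - ((1 - 2 * t) * h) ^ CARD('n) \<le> 2 * real CARD('n) * t * h ^ CARD('n)"
        unfolding power_mult_distrib by (simp add: left_diff_distrib)
    qed
    also have "\<dots> = ennreal (2 * real CARD('n) * t) * emeasure lebesgue Q"
      unfolding eQ using t h by (intro ennreal_mult) auto
    finally show ?thesis .
  qed
qed

text \<open>Boundary layers summed over disjoint cubes. The subfamily \<open>A\<close> is arbitrary
  because the estimate is applied both to the cubes whose side exceeds a given level and to all of
  them.\<close>

lemma emeasure_infdist_less_dyadic_dist:
  fixes Q0 E :: "(real ^ 'n) set" and t :: real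
  assumes E: "E \<noteq> {}" and Q0: "is_cube Q0" and A: "A \<subseteq> dyadic_avoiding E Q0" and t: "0 \<le> t"
  shows "emeasure lebesgue {x \<in> \<Union>A. infdist x E < t * dyadic_dist E Q0 x}
    \<le> ennreal (2 * real CARD('n) * t) * emeasure lebesgue (\<Union>A)"
proof -
  let ?X = "\<lambda>Q. {x \<in> Q. infdist x E < t * side Q}"
  have count: "countable A"
    using A countable_dyadic_avoiding[OF Q0] by (rule countable_subset)
  have sets: "Q \<in> sets lebesgue" if "Q \<in> A" for Q
    using that A sets_dyadic_avoiding[OF Q0] by blast
  have disj: "disjoint_family_on (\<lambda>Q. Q) A"
    using A disjoint_dyadic_avoiding[OF Q0, of E] unfolding disjoint_family_on_def disjoint_def by blast
  have "{x \<in> \<Union>A. infdist x E < t * dyadic_dist E Q0 x} = (\<Union>Q\<in>A. ?X Q)"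
  proof (rule set_eqI)
    fix x
    have "dyadic_dist E Q0 x = side Q" if "Q \<in> A" "x \<in> Q" for Q
      using that A by (intro dyadic_dist_eq[OF Q0]) auto
    then show "x \<in> {x \<in> \<Union>A. infdist x E < t * dyadic_dist E Q0 x} \<longleftrightarrow> x \<in> (\<Union>Q\<in>A. ?X Q)"
      by auto
  qed
  then have "emeasure lebesgue {x \<in> \<Union>A. infdist x E < t * dyadic_dist E Q0 x} = emeasure lebesgue (\<Union>Q\<in>A. ?X Q)"
    by simp
  also have "\<dots> = (\<integral>\<^sup>+Q. emeasure lebesgue (?X Q) \<partial>count_space A)"
  proof (rule emeasure_UN_countable[OF _ count])
    show "?X Q \<in> sets lebesgue" if "Q \<in> A" for Q
      using sets[OF that] by measurable
    show "disjoint_family_on ?X A"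
      using disj unfolding disjoint_family_on_def by blast
  qed
  also have "\<dots> \<le> (\<integral>\<^sup>+Q. ennreal (2 * real CARD('n) * t) * emeasure lebesgue Q \<partial>count_space A)"
  proof (rule nn_integral_mono)
    fix Q assume "Q \<in> space (count_space A)"
    then have Q: "Q \<in> dyadic_avoiding E Q0" using A by auto
    have "Q \<inter> closure E = {}" by (rule dyadic_avoidingE[OF Q0 Q])
    then show "emeasure lebesgue (?X Q) \<le> ennreal (2 * real CARD('n) * t) * emeasure lebesgue Q"
      by (rule emeasure_near_boundary[OF E dyadic_avoiding_is_cube[OF Q0 Q] _ t])
  qed
  also have "\<dots> = ennreal (2 * real CARD('n) * t) * (\<integral>\<^sup>+Q. emeasure lebesgue Q \<partial>count_space A)"
    by (rule nn_integral_cmult) simp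
  also have "(\<integral>\<^sup>+Q. emeasure lebesgue Q \<partial>count_space A) = emeasure lebesgue (\<Union>Q\<in>A. Q)"
    by (rule emeasure_UN_countable[symmetric, OF _ count disj]) (rule sets)
  finally show ?thesis by simp
qed

declare emeasure_completion [simp del]

section \<open>The two scales as quantiles of the dyadic distance\<close>

text \<open>A larger measure would make \<open>t\<close> admissible in the supremum. The bound is
  available strictly above the scale, which later costs a factor 2.\<close>

lemma upper_scale_less:
  fixes Q0 R :: "(real ^ 'n) set"
  assumes Q0: "is_cube Q0" and R: "R \<in> dyadic j Q0" "R \<inter> closure E \<noteq> {}"
    and t: "0 \<le> t" "upper_scale E s R < ennreal t"
  shows "emeasure lebesgue {x \<in> R - closure E. t \<le> dyadic_dist E Q0 x} \<le> ennreal s * emeasure lebesgue R"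
proof (rule ccontr)
  assume "\<not> ?thesis"
  then have "ennreal t \<le> upper_scale E s R"
    unfolding upper_scale_def infsum_dyadic_avoiding[OF Q0 R, where \<phi> = "\<lambda>l. _ \<le> l"]
    using t(1) by (intro Sup_upper) auto
  with t(2) show False by simp
qed

lemma lower_scale_greater:
  fixes Q0 R :: "(real ^ 'n) set"
  assumes Q0: "is_cube Q0" and R: "R \<in> dyadic j Q0" "R \<inter> closure E \<noteq> {}"
    and t: "0 \<le> t" "ennreal t < lower_scale E s R"
  shows "emeasure lebesgue {x \<in> R - closure E. dyadic_dist E Q0 x \<le> t} \<le> ennreal s * emeasure lebesgue R"
proof (rule ccontr)
  assume "\<not> ?thesis"
  then have "lower_scale E s R \<le> ennreal t"
    unfolding lower_scale_def infsum_dyadic_avoiding[OF Q0 R, where \<phi> = "\<lambda>l. l \<le> _"]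
    using t(1) by (intro Inf_lower) auto
  with t(2) show False by simp
qed

text \<open>The dyadic cubes of level \<open>j\<close> in \<open>Q\<close> that meet
  \<open>F\<close> shrink to \<open>Q \<inter> F\<close> as \<open>j\<close> grows, because
  \<open>F\<close> is closed. Summing the density bound over each level and passing to the limit
  shows that the measure of \<open>Q \<inter> F\<close> is at most \<open>c\<close> times itself,
  hence 0.\<close>

lemma null_sets_closed_of_density:
  fixes F :: "(real ^ 'n) set"
  assumes F: "closed F" and c: "0 \<le> c" "c < 1"
    and dens: "\<And>Q. is_cube Q \<Longrightarrow> Q \<inter> F \<noteq> {} \<Longrightarrow> emeasure lebesgue (Q \<inter> F) \<le> ennreal c * emeasure lebesgue Q"
  shows "F \<in> null_sets lebesgue"
proof -
  have Fs: "F \<in> sets lebesgue" using F by (simp add: borel_closed)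
  have clF: "closure F = F" using F by simp
  have null: "emeasure lebesgue (Q \<inter> F) = 0" if Q: "is_cube Q" for Q
  proof -
    let ?G = "\<lambda>j. {R \<in> dyadic j Q. R \<inter> F \<noteq> {}}"
    let ?V = "\<lambda>j. \<Union>(?G j)"
    have fin: "finite (?G j)" for j using finite_dyadic[OF Q] by simp
    have sets: "R \<in> sets lebesgue" if "R \<in> ?G j" for R j
      using that is_cube_sets is_cube_dyadic by blast
    have V_sets: "?V j \<in> sets lebesgue" for j
      using fin sets by (intro sets.finite_Union) auto
    have QF: "Q \<inter> F = (\<Union>R\<in>?G j. R \<inter> F)" for j
      using Union_dyadic[OF Q, of j] by blast
    have le: "emeasure lebesgue (Q \<inter> F) \<le> ennreal c * emeasure lebesgue (?V j)" for j
    proof -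
      have "emeasure lebesgue (Q \<inter> F) \<le> (\<Sum>R\<in>?G j. emeasure lebesgue (R \<inter> F))"
        unfolding QF[of j] using fin sets Fs by (intro emeasure_subadditive_finite) auto
      also have "\<dots> \<le> (\<Sum>R\<in>?G j. ennreal c * emeasure lebesgue R)"
        using dens is_cube_dyadic by (intro sum_mono) blast
      also have "\<dots> = ennreal c * (\<Sum>R\<in>?G j. emeasure lebesgue R)"
        by (rule sum_distrib_left[symmetric])
      also have "(\<Sum>R\<in>?G j. emeasure lebesgue R) = emeasure lebesgue (\<Union>R\<in>?G j. R)"
      proof (rule sum_emeasure)
        show "disjoint_family_on (\<lambda>R. R) (?G j)"
          using disjoint_dyadic[OF Q, of j] unfolding disjoint_family_on_def disjoint_def by blast
      qed (use fin sets in auto)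
      finally show ?thesis by simp
    qed
    have "(\<lambda>j. emeasure lebesgue (?V j)) \<longlonglongrightarrow> emeasure lebesgue (\<Inter>j. ?V j)"
    proof (rule Lim_emeasure_decseq)
      show "range ?V \<subseteq> sets lebesgue" using V_sets by blast
      show "decseq ?V"
      proof (rule decseq_SucI, rule subsetI)
        fix j x assume "x \<in> ?V (Suc j)"
        then obtain R where R: "R \<in> dyadic (Suc j) Q" "R \<inter> F \<noteq> {}" "x \<in> R" by blast
        then obtain P where P: "P \<in> dyadic j Q" "x \<in> P"
          using Union_dyadic[OF Q] dyadic_subset[OF Q R(1)] by blast
        have "R \<subseteq> P" using dyadic_nested(2)[OF Q P(1) R(1) _ P(2) R(3)] by simp
        with R P show "x \<in> ?V j" by blast
      qed
      show "emeasure lebesgue (?V j) \<noteq> \<infinity>" for j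
      proof -
        have "emeasure lebesgue (?V j) \<le> emeasure lebesgue Q"
          using dyadic_subset[OF Q] by (intro emeasure_mono is_cube_sets Q) blast
        with emeasure_is_cube_finite[OF Q] show ?thesis by (auto simp: top_unique)
      qed
    qed
    also have "(\<Inter>j. ?V j) = Q \<inter> F"
    proof
      show "Q \<inter> F \<subseteq> (\<Inter>j. ?V j)" using QF by blast
      show "(\<Inter>j. ?V j) \<subseteq> Q \<inter> F"
      proof (rule ccontr)
        assume "\<not> ?thesis"
        then obtain x where x: "\<And>j. x \<in> ?V j" "x \<notin> Q \<inter> F" by blast
        have "x \<in> Q" using x(1)[of 0] dyadic_subset[OF Q] by blast
        then have "x \<notin> closure F" using x(2) clF by auto
        then obtain j R where R: "R \<in> dyadic j Q" "x \<in> R" "R \<inter> closure F = {}"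
          using dyadic_small[OF Q \<open>x \<in> Q\<close>] by blast
        obtain R' where R': "R' \<in> dyadic j Q" "x \<in> R'" "R' \<inter> F \<noteq> {}" using x(1)[of j] by blast
        have "R = R'" using disjoint_dyadic[OF Q, of j] R R' unfolding disjoint_def by blast
        with R R' clF show False by simp
      qed
    qed
    finally have "(\<lambda>j. ennreal c * emeasure lebesgue (?V j)) \<longlonglongrightarrow> ennreal c * emeasure lebesgue (Q \<inter> F)"
      by (intro ennreal_tendsto_cmult) simp_all
    then have le: "emeasure lebesgue (Q \<inter> F) \<le> ennreal c * emeasure lebesgue (Q \<inter> F)"
      using le by (intro LIMSEQ_le_const) auto
    have "emeasure lebesgue (Q \<inter> F) \<le> emeasure lebesgue Q"
      by (intro emeasure_mono is_cube_sets Q) blast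
    then obtain m where m: "0 \<le> m" "emeasure lebesgue (Q \<inter> F) = ennreal m"
      using emeasure_is_cube_finite[OF Q] by (cases "emeasure lebesgue (Q \<inter> F)") (auto simp: top_unique)
    then have "m \<le> c * m" using le c by (simp add: ennreal_mult[symmetric])
    then have "m = 0" using m(1) c by (smt (verit) mult_le_cancel_right1)
    with m show ?thesis by simp
  qed
  have "F = (\<Union>k. cube (\<chi> i. - real (Suc k)) (2 * real (Suc k)) \<inter> F)"
  proof (intro subset_antisym subsetI)
    fix x assume "x \<in> F"
    obtain k where k: "norm x < real k" using reals_Archimedean2 by blast
    have "x \<in> cube (\<chi> i. - real (Suc k)) (2 * real (Suc k))"
      unfolding cube_def
    proof (intro CollectI allI)
      fix i
      have "\<bar>x $ i\<bar> < real k" using k component_le_norm_cart[of x i] by simp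
      then show "(\<chi> i. - real (Suc k)) $ i \<le> x $ i \<and> x $ i < (\<chi> i. - real (Suc k)) $ i + 2 * real (Suc k)"
        by auto
    qed
    with \<open>x \<in> F\<close> show "x \<in> (\<Union>k. cube (\<chi> i. - real (Suc k)) (2 * real (Suc k)) \<inter> F)" by blast
  qed blast
  also have "\<dots> \<in> null_sets lebesgue"
  proof (rule null_sets_UN)
    fix k
    have "is_cube (cube (\<chi> i. - real (Suc k)) (2 * real (Suc k)) :: (real ^ 'n) set)"
      unfolding is_cube_def by (intro exI conjI) auto
    then show "cube (\<chi> i. - real (Suc k)) (2 * real (Suc k)) \<inter> F \<in> null_sets lebesgue"
      using null Fs is_cube_sets by (intro null_setsI) auto
  qed
  finally show ?thesis .
qed

section \<open>From weights to scales\<close>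

lemma epowr_1 [simp]: "epowr x 1 = x"
  by (cases x) (auto simp: epowr_def)

text \<open>At base 0 the conventions are consistent: the inner power is 0 or infinite according to
  the sign of \<open>\<theta>\<close>, and the negative outer exponent exchanges these two
  values.\<close>

lemma epowr_epowr_uminus:
  assumes "\<theta> \<noteq> 0" "0 < t"
  shows "epowr (epowr (ennreal r) \<theta>) (- t) = epowr (ennreal r) (- (\<theta> * t))"
proof (cases "0 < r")
  case True
  then show ?thesis
    using assms by (auto simp: epowr_def powr_powr ennreal_eq_0_iff)
next
  case False
  then have "ennreal r = 0" by (simp add: ennreal_eq_0_iff)
  then show ?thesis
    using assms by (auto simp: epowr_def mult_less_0_iff zero_less_mult_iff)
qed

lemma epowr_ennreal: "0 < r \<Longrightarrow> epowr (ennreal r) t = ennreal (r powr t)"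
  by (auto simp: epowr_def ennreal_eq_0_iff)

lemma epowr_infdist_measurable [measurable]: "(\<lambda>x. epowr (ennreal (infdist x E)) t) \<in> borel_measurable lebesgue"
  unfolding epowr_def by measurable

lemma average_ge:
  assumes "0 < emeasure M Q" "emeasure M Q < \<infinity>" "S \<in> sets M" "S \<subseteq> Q"
    and ge: "\<And>x. x \<in> S \<Longrightarrow> b \<le> F x" and S: "a * emeasure M Q \<le> emeasure M S"
  shows "b * a \<le> (\<integral>\<^sup>+x\<in>Q. F x \<partial>M) / emeasure M Q"
proof -
  have "b * a * emeasure M Q \<le> b * emeasure M S"
    using S by (simp add: mult.assoc mult_left_mono)
  also have "\<dots> = (\<integral>\<^sup>+x. b * indicator S x \<partial>M)"
    using assms(3) by (simp add: nn_integral_cmult_indicator)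
  also have "\<dots> \<le> (\<integral>\<^sup>+x\<in>Q. F x \<partial>M)"
    using ge assms(4) by (intro nn_integral_mono) (auto simp: indicator_def)
  finally have "b * a * emeasure M Q / emeasure M Q \<le> (\<integral>\<^sup>+x\<in>Q. F x \<partial>M) / emeasure M Q"
    by (rule divide_right_mono_ennreal)
  then show ?thesis
    using assms(1,2) by (simp add: ennreal_mult_divide_eq)
qed

text \<open>On the closure the power is 0 for positive \<open>\<theta>\<close>, against positivity
  almost everywhere, and infinite for negative \<open>\<theta>\<close>, against local
  integrability.\<close>

lemma null_sets_closure_of_weight:
  fixes E :: "(real ^ 'n) set"
  assumes E: "E \<noteq> {}" and w: "weight (\<lambda>x. epowr (ennreal (infdist x E)) \<theta>)" and \<theta>: "\<theta> \<noteq> 0"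
  shows "closure E \<in> null_sets lebesgue"
proof -
  have cl: "closure E \<in> sets lebesgue" by (simp add: borel_closed)
  have zero: "infdist x E = 0" if "x \<in> closure E" for x
    using that E in_closure_iff_infdist_zero by blast
  show ?thesis
  proof (cases "0 < \<theta>")
    case True
    have "AE x in lebesgue. 0 < epowr (ennreal (infdist x E)) \<theta>"
      using w by (simp add: weight_def)
    then have "AE x in lebesgue. x \<notin> closure E"
      by eventually_elim (use True zero in \<open>auto simp: epowr_def\<close>)
    then show ?thesis using cl by (simp add: AE_iff_null_sets)
  next
    case False
    have "closure E \<inter> cball 0 (real k) \<in> null_sets lebesgue" for k
    proof -
      let ?K = "cball 0 (real k) :: (real ^ 'n) set"
      have "\<infinity> * emeasure lebesgue (closure E \<inter> ?K) = (\<integral>\<^sup>+x. \<infinity> * indicator (closure E \<inter> ?K) x \<partial>lebesgue)"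
        using cl by (subst nn_integral_cmult_indicator) auto
      also have "\<dots> \<le> (\<integral>\<^sup>+x\<in>?K. epowr (ennreal (infdist x E)) \<theta> \<partial>lebesgue)"
        using False \<theta> zero by (intro nn_integral_mono) (auto simp: indicator_def epowr_def)
      also have "\<dots> < \<infinity>" using w by (simp add: weight_def)
      finally have "emeasure lebesgue (closure E \<inter> ?K) = 0"
        by (auto simp: ennreal_top_mult split: if_splits)
      then show ?thesis using cl by (intro null_setsI) auto
    qed
    then have "(\<Union>k. closure E \<inter> cball 0 (real k)) \<in> null_sets lebesgue" by (intro null_sets_UN) auto
    also have "(\<Union>k. closure E \<inter> cball 0 (real k)) = closure E"
      using real_arch_simple by (fastforce simp: dist_norm)
    finally show ?thesis .
  qed
qed

text \<open>Let \<open>x\<close> be admissible in the supremum and \<open>y\<close> in the infimum.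
  The distance is at most \<open>2 * n * y\<close> on a set of relative size \<open>s\<close> and at
  least \<open>x / (4 * n)\<close> on one of relative size \<open>s / 2\<close>, up to null sets.
  These sets bound the averages of the negative and the positive power from below, so
  \<open>A2\<close> bounds \<open>x / y\<close>.\<close>

lemma A2_imp_scale_bound:
  fixes E :: "(real ^ 'n) set"
  assumes E: "E \<noteq> {}" "closure E \<in> null_sets lebesgue" and Q0: "is_cube Q0" "Q0 \<inter> closure E \<noteq> {}"
    and pos: "0 < \<alpha>" "0 < C" "0 < s" "s < 1"
    and A2: "(\<integral>\<^sup>+x\<in>Q0. epowr (ennreal (infdist x E)) (- \<alpha>) \<partial>lebesgue) / emeasure lebesgue Q0 *
      ((\<integral>\<^sup>+x\<in>Q0. epowr (ennreal (infdist x E)) \<alpha> \<partial>lebesgue) / emeasure lebesgue Q0) \<le> ennreal C"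
  shows "0 < upper_scale E s Q0 / lower_scale E s Q0 \<and>
    upper_scale E s Q0 / lower_scale E s Q0 \<le> ennreal (8 * real CARD('n) ^ 2 * (2 * C / s ^ 2) powr (1 / \<alpha>))"
proof -
  let ?d = "dyadic_dist E Q0" and ?m = "emeasure lebesgue Q0"
  define n where "n = real CARD('n)"
  have n: "0 < n" by (simp add: n_def)
  \<comment> \<open>\<open>8 * n ^ 2\<close> multiplies the losses \<open>2 * n\<close> and
    \<open>4 * n\<close> of the comparison between the distance and the dyadic distance;
    \<open>s ^ 2 / 2\<close> multiplies the two relative sizes.\<close>
  define K where "K = 8 * n ^ 2 * (2 * C / s ^ 2) powr (1 / \<alpha>)"
  have K: "0 < K" using n pos by (simp add: K_def)
  have Q00: "Q0 \<in> dyadic 0 Q0" using dyadic_0[OF Q0(1)] by simp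
  have [measurable]: "Q0 \<in> sets lebesgue" "closure E \<in> sets lebesgue" "?d \<in> borel_measurable lebesgue"
    using is_cube_sets[OF Q0(1)] E(2) dyadic_dist_measurable[OF Q0(1)] by auto
  have diff: "emeasure lebesgue (Q0 - closure E) = ?m"
    using E(2) by (rule emeasure_Diff_null_set) simp
  have m: "0 < ?m" "?m < \<infinity>"
    using emeasure_is_cube_pos[OF Q0(1)] emeasure_is_cube_finite[OF Q0(1)] by auto
  have side_le: "?d x \<le> side Q0" if x: "x \<in> Q0 - closure E" for x
  proof -
    obtain Q where Q: "Q \<in> dyadic_avoiding E Q0" "?d x = side Q"
      using dyadic_avoiding_cover[OF Q0 x] by metis
    obtain j where "Q \<in> dyadic (Suc j) Q0" by (rule dyadic_avoidingE[OF Q0(1) Q(1)])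
    then have "side Q = side Q0 / 2 ^ Suc j" by (rule side_dyadic)
    also have "\<dots> \<le> side Q0 / 1"
      using side_pos[OF Q0(1)] one_le_power[of "2 :: real" "Suc j"] by (intro divide_left_mono) auto
    finally show ?thesis using Q(2) by simp
  qed
  let ?U = "{L. 0 \<le> L \<and> ennreal s * ?m \<le> emeasure lebesgue {x \<in> Q0 - closure E. L \<le> ?d x}}"
  let ?L = "{L. 0 \<le> L \<and> ennreal s * ?m \<le> emeasure lebesgue {x \<in> Q0 - closure E. ?d x \<le> L}}"
  have U: "upper_scale E s Q0 = Sup (ennreal ` ?U)"
    unfolding upper_scale_def infsum_dyadic_avoiding[OF Q0(1) Q00 Q0(2), where \<phi> = "\<lambda>l. _ \<le> l"]
    by (rule arg_cong[where f = Sup]) auto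
  have L: "lower_scale E s Q0 = Inf (ennreal ` ?L)"
    unfolding lower_scale_def infsum_dyadic_avoiding[OF Q0(1) Q00 Q0(2), where \<phi> = "\<lambda>l. l \<le> _"]
    by (rule arg_cong[where f = Inf]) auto
  have le: "x \<le> K * y" if x: "x \<in> ?U" and y: "y \<in> ?L" for x y
  proof (cases "x = 0")
    case True
    then show ?thesis using K y by simp
  next
    case False
    then have x0: "0 < x" using x by simp
    have spos: "0 < ennreal s * ?m" using pos m by (simp add: ennreal_zero_less_mult_iff)
    \<comment> \<open>Level 0 is not admissible in the infimum: the dyadic distance is positive off
      the closure, and the required measure is positive.\<close>
    have y0: "0 < y"
    proof (rule ccontr)
      assume "\<not> 0 < y"
      then have "\<not> ?d z \<le> y" if "z \<in> Q0 - closure E" for z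
        using dyadic_dist_pos[OF Q0 that] by linarith
      then have empty: "{x \<in> Q0 - closure E. ?d x \<le> y} = {}" by blast
      from y have "ennreal s * ?m \<le> emeasure lebesgue {x \<in> Q0 - closure E. ?d x \<le> y}" by blast
      from order_less_le_trans[OF spos this] show False unfolding empty by simp
    qed
    have low: "ennreal ((2 * n * y) powr (- \<alpha>)) * ennreal s
        \<le> (\<integral>\<^sup>+x\<in>Q0. epowr (ennreal (infdist x E)) (- \<alpha>) \<partial>lebesgue) / ?m"
    proof (rule average_ge[OF m, where S = "{x \<in> Q0 - closure E. ?d x \<le> y}"])
      fix z assume z: "z \<in> {x \<in> Q0 - closure E. ?d x \<le> y}"
      then have "0 < infdist z E"
        using in_closure_iff_infdist_zero[OF E(1), of z] infdist_nonneg[of z E] by auto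
      moreover have "infdist z E \<le> 2 * n * y"
      proof -
        have "infdist z E \<le> 2 * n * ?d z"
          using infdist_le_dyadic_dist[OF Q0, of z] z by (simp add: n_def)
        also have "\<dots> \<le> 2 * n * y"
          using z n by (intro mult_left_mono) auto
        finally show ?thesis .
      qed
      ultimately show "ennreal ((2 * n * y) powr (- \<alpha>)) \<le> epowr (ennreal (infdist z E)) (- \<alpha>)"
        using pos(1) by (simp add: epowr_ennreal ennreal_leI powr_mono2')
    qed (use y in auto)
    let ?A = "{Q \<in> dyadic_avoiding E Q0. x \<le> side Q}"
    have A: "\<Union>?A = {z \<in> Q0 - closure E. x \<le> ?d z}"
      by (rule Union_dyadic_avoiding_side[OF Q0(1) Q00 Q0(2), where \<phi> = "\<lambda>l. x \<le> l"])
    have [measurable]: "\<Union>?A \<in> sets lebesgue" unfolding A by measurable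
    \<comment> \<open>The factor \<open>1 / (4 * n)\<close> is chosen so that the discarded boundary
      layers take at most half of the union.\<close>
    let ?G = "{z \<in> \<Union>?A. 1 / (4 * n) * ?d z \<le> infdist z E}"
    have up: "ennreal ((x / (4 * n)) powr \<alpha>) * ennreal (s / 2)
        \<le> (\<integral>\<^sup>+x\<in>Q0. epowr (ennreal (infdist x E)) \<alpha> \<partial>lebesgue) / ?m"
    proof (rule average_ge[OF m, where S = ?G])
      show "?G \<subseteq> Q0" unfolding A by blast
      show "?G \<in> sets lebesgue" by measurable
      show "ennreal (s / 2) * ?m \<le> emeasure lebesgue ?G"
      proof -
        let ?B = "{z \<in> \<Union>?A. infdist z E < 1 / (4 * n) * ?d z}"
        have "emeasure lebesgue (\<Union>?A) \<le> ?m"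
          unfolding A by (intro emeasure_mono) auto
        then obtain u where u: "0 \<le> u" "emeasure lebesgue (\<Union>?A) = ennreal u"
          using m(2) by (cases "emeasure lebesgue (\<Union>?A)") (auto simp: top_unique)
        have "emeasure lebesgue ?B \<le> ennreal (2 * n * (1 / (4 * n))) * emeasure lebesgue (\<Union>?A)"
          using n unfolding n_def by (intro emeasure_infdist_less_dyadic_dist[OF E(1) Q0(1)]) auto
        also have "2 * n * (1 / (4 * n)) = 1 / 2" using n by simp
        also have "ennreal (1 / 2) * emeasure lebesgue (\<Union>?A) = ennreal (u / 2)"
          unfolding u(2) using u(1) by (subst ennreal_mult[symmetric]) auto
        finally have B: "emeasure lebesgue ?B \<le> ennreal (u / 2)" .
        have "ennreal u = emeasure lebesgue (?B \<union> ?G)"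
          unfolding u(2)[symmetric] by (rule arg_cong[where f = "emeasure lebesgue"]) auto
        also have "\<dots> \<le> emeasure lebesgue ?B + emeasure lebesgue ?G"
          by (rule emeasure_subadditive) measurable
        also have "\<dots> \<le> ennreal (u / 2) + emeasure lebesgue ?G"
          by (intro add_mono B order_refl)
        finally have "ennreal u - ennreal (u / 2) \<le> emeasure lebesgue ?G"
          by (subst ennreal_minus_le_iff) (simp add: add.commute)
        then have *: "ennreal (u / 2) \<le> emeasure lebesgue ?G"
          using u(1) by (simp add: ennreal_minus)
        have "ennreal (s / 2) * ?m = ennreal (1 / 2) * (ennreal s * ?m)"
          using pos by (subst mult.assoc[symmetric], subst ennreal_mult[symmetric]) auto
        also have "\<dots> \<le> ennreal (1 / 2) * ennreal u"
          using x unfolding u(2)[symmetric] A by (intro mult_left_mono) auto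
        also have "\<dots> = ennreal (u / 2)"
          using u(1) by (subst ennreal_mult[symmetric]) auto
        finally show ?thesis using * by (rule order_trans)
      qed
      fix z assume z: "z \<in> ?G"
      then have "x \<le> ?d z" unfolding A by simp
      then have "x / (4 * n) \<le> 1 / (4 * n) * ?d z" using n by (simp add: divide_right_mono)
      then have "x / (4 * n) \<le> infdist z E" using z by simp
      moreover have "0 < x / (4 * n)" using x0 n by simp
      ultimately show "ennreal ((x / (4 * n)) powr \<alpha>) \<le> epowr (ennreal (infdist z E)) \<alpha>"
        using pos(1) by (subst epowr_ennreal) (auto intro!: ennreal_leI powr_mono2)
    qed
    define r where "r = x / (8 * n ^ 2 * y)"
    have r: "0 < r" using x0 y0 n by (simp add: r_def)
    have "ennreal ((2 * n * y) powr (- \<alpha>)) * ennreal s * (ennreal ((x / (4 * n)) powr \<alpha>) * ennreal (s / 2)) \<le> ennreal C"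
      by (rule order_trans[OF mult_mono[OF low up] A2]) simp_all
    also have "ennreal ((2 * n * y) powr (- \<alpha>)) * ennreal s * (ennreal ((x / (4 * n)) powr \<alpha>) * ennreal (s / 2))
        = ennreal ((2 * n * y) powr (- \<alpha>) * s * ((x / (4 * n)) powr \<alpha> * (s / 2)))"
    proof -
      have "0 \<le> s" "0 \<le> s / 2" using pos(3) by auto
      then show ?thesis
        by (simp only: ennreal_mult[symmetric] powr_ge_zero mult_nonneg_nonneg)
    qed
    finally have "(2 * n * y) powr (- \<alpha>) * s * ((x / (4 * n)) powr \<alpha> * (s / 2)) \<le> C"
      using pos(2) by (subst (asm) ennreal_le_iff) auto
    moreover have "(2 * n * y) powr (- \<alpha>) * (x / (4 * n)) powr \<alpha> = r powr \<alpha>"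
    proof -
      have "(2 * n * y) powr (- \<alpha>) * (x / (4 * n)) powr \<alpha> = (x / (4 * n)) powr \<alpha> / (2 * n * y) powr \<alpha>"
        unfolding powr_minus_divide by simp
      also have "\<dots> = ((x / (4 * n)) / (2 * n * y)) powr \<alpha>"
        using x0 y0 n by (subst powr_divide) auto
      also have "(x / (4 * n)) / (2 * n * y) = r"
        by (simp add: r_def power2_eq_square)
      finally show ?thesis .
    qed
    moreover have "(2 * n * y) powr (- \<alpha>) * s * ((x / (4 * n)) powr \<alpha> * (s / 2))
        = ((2 * n * y) powr (- \<alpha>) * (x / (4 * n)) powr \<alpha>) * (s ^ 2 / 2)"
      by (simp add: power2_eq_square)
    ultimately have "r powr \<alpha> * (s ^ 2 / 2) \<le> C" by simp
    then have "r powr \<alpha> \<le> 2 * C / s ^ 2"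
      using pos by (simp add: field_simps)
    then have "(r powr \<alpha>) powr (1 / \<alpha>) \<le> (2 * C / s ^ 2) powr (1 / \<alpha>)"
      using pos(1) by (intro powr_mono2) auto
    then have "r \<le> (2 * C / s ^ 2) powr (1 / \<alpha>)"
      using pos(1) r by (simp add: powr_powr)
    then have "r * (8 * n ^ 2 * y) \<le> (2 * C / s ^ 2) powr (1 / \<alpha>) * (8 * n ^ 2 * y)"
      using y0 n by (intro mult_right_mono) auto
    moreover have "r * (8 * n ^ 2 * y) = x" using y0 n by (simp add: r_def)
    ultimately show ?thesis by (simp add: K_def mult_ac)
  qed
  have Upos: "0 < upper_scale E s Q0"
  proof -
    \<comment> \<open>These sets exhaust \<open>Q0\<close> up to a null set, so some positive level
      keeps more than the fraction \<open>s < 1\<close>.\<close>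
    let ?X = "\<lambda>k. {x \<in> Q0 - closure E. 1 / real (Suc k) \<le> ?d x}"
    have "incseq ?X"
    proof (rule incseq_SucI, rule subsetI)
      fix k z assume "z \<in> ?X k"
      moreover have "1 / real (Suc (Suc k)) \<le> 1 / real (Suc k)" by (intro divide_left_mono) auto
      ultimately show "z \<in> ?X (Suc k)" by auto
    qed
    then have "(SUP k. emeasure lebesgue (?X k)) = emeasure lebesgue (\<Union>k. ?X k)"
      by (intro SUP_emeasure_incseq) auto
    also have "(\<Union>k. ?X k) = Q0 - closure E"
    proof (intro subset_antisym subsetI)
      fix z assume z: "z \<in> Q0 - closure E"
      obtain k where "inverse (real (Suc k)) < ?d z"
        using reals_Archimedean[OF dyadic_dist_pos[OF Q0 z]] by blast
      with z show "z \<in> (\<Union>k. ?X k)" by (auto simp: inverse_eq_divide intro: less_imp_le)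
    qed blast
    finally have "(SUP k. emeasure lebesgue (?X k)) = ?m" using diff by simp
    moreover have "ennreal s * ?m < ?m"
    proof -
      obtain r where "0 < r" "?m = ennreal r" using m by (cases ?m) auto
      then show ?thesis using pos by (simp add: ennreal_mult[symmetric] ennreal_lessI)
    qed
    ultimately have "ennreal s * ?m < (SUP k. emeasure lebesgue (?X k))" by simp
    then obtain k where "ennreal s * ?m < emeasure lebesgue (?X k)"
      by (auto simp: less_SUP_iff)
    then have "1 / real (Suc k) \<in> ?U" by (auto intro: less_imp_le)
    then have "ennreal (1 / real (Suc k)) \<le> upper_scale E s Q0"
      unfolding U by (intro Sup_upper imageI)
    moreover have "0 < ennreal (1 / real (Suc k))" by simp
    ultimately show ?thesis by (rule order_less_le_trans[rotated])
  qed
  have Lfin: "lower_scale E s Q0 < \<infinity>"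
  proof -
    have "{x \<in> Q0 - closure E. ?d x \<le> side Q0} = Q0 - closure E"
      using side_le by auto
    moreover have "ennreal s * ?m \<le> 1 * ?m" using pos by (intro mult_right_mono) auto
    ultimately have "side Q0 \<in> ?L" using side_pos[OF Q0(1)] diff by simp
    then have "lower_scale E s Q0 \<le> ennreal (side Q0)"
      unfolding L by (intro Inf_lower imageI)
    then show ?thesis by (rule order_le_less_trans) simp
  qed
  have UL: "upper_scale E s Q0 \<le> ennreal K * lower_scale E s Q0"
  proof -
    have "upper_scale E s Q0 / ennreal K \<le> lower_scale E s Q0"
      unfolding L
    proof (rule Inf_greatest)
      fix v assume "v \<in> ennreal ` ?L"
      then obtain y where y: "y \<in> ?L" "v = ennreal y" by blast
      have "upper_scale E s Q0 \<le> ennreal (K * y)"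
        unfolding U using le[OF _ y(1)] by (intro Sup_least) (auto intro: ennreal_leI)
      then show "upper_scale E s Q0 / ennreal K \<le> v"
        using K y by (intro divide_le_posI_ennreal) (auto simp: ennreal_mult[symmetric] mult.commute)
    qed
    then have "ennreal K * (upper_scale E s Q0 / ennreal K) \<le> ennreal K * lower_scale E s Q0"
      by (rule mult_left_mono) simp
    moreover have "ennreal K * (upper_scale E s Q0 / ennreal K) = upper_scale E s Q0"
      using K by (simp add: ennreal_times_divide mult.commute[of "ennreal K"] ennreal_mult_divide_eq)
    ultimately show ?thesis by simp
  qed
  then have "0 < lower_scale E s Q0"
    using Upos by (auto simp: zero_less_iff_neq_zero)
  with UL have "upper_scale E s Q0 / lower_scale E s Q0 \<le> ennreal K"
    by (intro divide_le_posI_ennreal) (simp_all add: mult.commute)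
  moreover have "0 < upper_scale E s Q0 / lower_scale E s Q0"
    using Upos Lfin by (simp add: ennreal_zero_less_divide)
  ultimately show ?thesis by (simp add: K_def n_def)
qed

text \<open>At exponent 2 the dual weight is the reciprocal, so the condition is symmetric under the
  exchange of \<open>\<theta>\<close> and \<open>- \<theta>\<close>, and
  \<open>\<bar>\<theta>\<bar>\<close> can be used as the positive exponent.\<close>

lemma Muckenhoupt_imp_scale_bound:
  fixes E :: "(real ^ 'n) set"
  assumes E: "E \<noteq> {}" and \<theta>: "\<theta> \<noteq> 0" and w: "(\<lambda>x. epowr (ennreal (infdist x E)) \<theta>) \<in> Muckenhoupt 2"
  obtains C0 s where "0 < C0" "0 < s" "s < inverse (1 + 2 ^ CARD('n))"
    "\<And>Q0. is_cube Q0 \<Longrightarrow> Q0 \<inter> closure E \<noteq> {} \<Longrightarrow>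
      0 < upper_scale E s Q0 / lower_scale E s Q0 \<and> upper_scale E s Q0 / lower_scale E s Q0 \<le> ennreal C0"
proof -
  let ?w = "\<lambda>x t. epowr (ennreal (infdist x E)) t"
  have wt: "weight (\<lambda>x. ?w x \<theta>)" using w by (simp add: Muckenhoupt_def)
  have null: "closure E \<in> null_sets lebesgue" by (rule null_sets_closure_of_weight[OF E wt \<theta>])
  obtain C where C: "0 < C" "\<And>Q. is_cube Q \<Longrightarrow>
    (\<integral>\<^sup>+x\<in>Q. ?w x \<theta> \<partial>lebesgue) / emeasure lebesgue Q *
      epowr ((\<integral>\<^sup>+x\<in>Q. epowr (?w x \<theta>) (- 1 / (2 - 1)) \<partial>lebesgue) / emeasure lebesgue Q) (2 - 1) \<le> ennreal C"
    using w unfolding Muckenhoupt_def by blast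
  have A2: "(\<integral>\<^sup>+x\<in>Q. ?w x \<theta> \<partial>lebesgue) / emeasure lebesgue Q *
      ((\<integral>\<^sup>+x\<in>Q. ?w x (- \<theta>) \<partial>lebesgue) / emeasure lebesgue Q) \<le> ennreal C" if "is_cube Q" for Q
    using C(2)[OF that] epowr_epowr_uminus[OF \<theta>, of 1] by simp
  define s :: real where "s = inverse (2 + 2 ^ CARD('n))"
  have "(0 :: real) < 2 ^ CARD('n)" by simp
  then have s: "0 < s" "s < 1" "s < inverse (1 + 2 ^ CARD('n))"
    unfolding s_def by (auto intro!: inverse_less_1_iff[THEN iffD2] less_imp_inverse_less add_pos_pos)
  define C0 where "C0 = 8 * real CARD('n) ^ 2 * (2 * C / s ^ 2) powr (1 / \<bar>\<theta>\<bar>)"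
  show thesis
  proof (rule that[of C0 s])
    show "0 < C0" using C(1) s by (simp add: C0_def)
    fix Q0 assume Q0: "is_cube Q0" "Q0 \<inter> closure E \<noteq> {}"
    show "0 < upper_scale E s Q0 / lower_scale E s Q0 \<and> upper_scale E s Q0 / lower_scale E s Q0 \<le> ennreal C0"
      unfolding C0_def
    proof (rule A2_imp_scale_bound[OF E null Q0 _ C(1) s(1,2)])
      show "(\<integral>\<^sup>+x\<in>Q0. ?w x (- \<bar>\<theta>\<bar>) \<partial>lebesgue) / emeasure lebesgue Q0 *
          ((\<integral>\<^sup>+x\<in>Q0. ?w x \<bar>\<theta>\<bar> \<partial>lebesgue) / emeasure lebesgue Q0) \<le> ennreal C"
      proof (cases "0 < \<theta>")
        case True
        then show ?thesis using A2[OF Q0(1)] by (simp only: abs_of_pos mult.commute)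
      next
        case False
        then have "\<bar>\<theta>\<bar> = - \<theta>" by simp
        then show ?thesis using A2[OF Q0(1)] by simp
      qed
    qed (use \<theta> in simp)
  qed (use s in auto)
qed

section \<open>From scales to weights\<close>

text \<open>A positive supremum yields an admissible level, hence avoiding cubes that fill the
  fraction \<open>s\<close> of \<open>Q\<close>. The closure thus has density at most
  \<open>1 - s\<close> in every cube that it meets.\<close>

lemma null_sets_closure_of_upper_scale:
  fixes E :: "(real ^ 'n) set"
  assumes s: "0 < s" "s < 1"
    and pos: "\<And>Q. is_cube Q \<Longrightarrow> Q \<inter> closure E \<noteq> {} \<Longrightarrow> 0 < upper_scale E s Q"
  shows "closure E \<in> null_sets lebesgue"
proof (rule null_sets_closed_of_density[where c = "1 - s"])
  fix Q :: "(real ^ 'n) set" assume Q: "is_cube Q" "Q \<inter> closure E \<noteq> {}"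
  have Q0: "Q \<in> dyadic 0 Q" using dyadic_0[OF Q(1)] by simp
  have cl: "closure E \<in> sets lebesgue" by (simp add: borel_closed)
  note [measurable] = is_cube_sets[OF Q(1)]
  obtain L where "ennreal s * emeasure lebesgue Q \<le> emeasure lebesgue {x \<in> Q - closure E. L \<le> dyadic_dist E Q x}"
    using pos[OF Q]
    unfolding upper_scale_def infsum_dyadic_avoiding[OF Q(1) Q0 Q(2), where \<phi> = "\<lambda>l. _ \<le> l"]
    by (auto simp: less_Sup_iff)
  also have "\<dots> \<le> emeasure lebesgue (Q - closure E)"
    by (rule emeasure_mono) (use is_cube_sets[OF Q(1)] cl in auto)
  finally have le: "ennreal s * emeasure lebesgue Q \<le> emeasure lebesgue (Q - closure E)" .
  define m where "m = side Q ^ CARD('n)"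
  have m: "0 < m" "emeasure lebesgue Q = ennreal m"
    using emeasure_is_cube[OF Q(1)] side_pos[OF Q(1)] by (auto simp: m_def)
  have "emeasure lebesgue (Q \<inter> closure E) \<le> emeasure lebesgue Q"
    by (intro emeasure_mono is_cube_sets Q) blast
  then obtain v where v: "0 \<le> v" "emeasure lebesgue (Q \<inter> closure E) = ennreal v"
    using m by (cases "emeasure lebesgue (Q \<inter> closure E)") (auto simp: top_unique)
  have "emeasure lebesgue (Q - closure E) \<le> emeasure lebesgue Q"
    by (intro emeasure_mono is_cube_sets Q) blast
  then obtain u where u: "0 \<le> u" "emeasure lebesgue (Q - closure E) = ennreal u"
    using m by (cases "emeasure lebesgue (Q - closure E)") (auto simp: top_unique)
  have "emeasure lebesgue (Q - closure E) + emeasure lebesgue (Q \<inter> closure E)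
      = emeasure lebesgue ((Q - closure E) \<union> (Q \<inter> closure E))"
    using cl is_cube_sets[OF Q(1)] by (intro plus_emeasure) auto
  also have "(Q - closure E) \<union> (Q \<inter> closure E) = Q" by blast
  finally have "u + v = m"
    using u v m by (simp add: ennreal_plus[symmetric] del: ennreal_plus)
  moreover have "s * m \<le> u"
    using le u m s by (simp add: ennreal_mult[symmetric])
  ultimately have "v \<le> (1 - s) * m" by (simp add: algebra_simps)
  then show "emeasure lebesgue (Q \<inter> closure E) \<le> ennreal (1 - s) * emeasure lebesgue Q"
    using m v s by (simp add: ennreal_mult[symmetric] ennreal_leI)
qed (use s in auto)

section \<open>Exponential tails of the logarithm of the dyadic distance\<close>

text \<open>A positive quotient in \<open>ennreal\<close> excludes \<open>U = 0\<close> and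
  \<open>L = \<infinity>\<close>; a finite one then excludes \<open>L = 0\<close> and
  \<open>U = \<infinity>\<close>.\<close>

lemma scale_ratio_cases:
  fixes U L :: ennreal
  assumes "0 < U / L" "U / L \<le> ennreal C"
  obtains u l where "U = ennreal u" "L = ennreal l" "0 < u" "0 < l" "u \<le> C * l"
proof -
  have U: "0 < U" "L < top" using assms(1) by (auto simp: ennreal_zero_less_divide)
  have fin: "U / L \<noteq> top" using assms(2) by (auto simp: top_unique)
  then have L: "L \<noteq> 0" using U by (auto simp: ennreal_divide_eq_top_iff)
  have U': "U \<noteq> top" using fin U by (auto simp: ennreal_divide_eq_top_iff)
  obtain u where u: "U = ennreal u" "0 \<le> u" using U' by (cases U) auto
  obtain l where l: "L = ennreal l" "0 \<le> l" using U(2) by (cases L) auto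
  have pos: "0 < u" "0 < l" using u l U L by (auto simp: less_le)
  have "U / L = ennreal (u / l)" using u l pos by (simp add: divide_ennreal)
  then have "ennreal (u / l) \<le> ennreal C" using assms(2) by simp
  moreover have "0 < u / l" using pos by simp
  ultimately have "u / l \<le> C" by (metis ennreal_le_iff2 linorder_not_le)
  then have "u \<le> C * l" using pos by (simp add: field_simps)
  with u l pos that show thesis by blast
qed

text \<open>The bounded ratio of the two scales says that on every dyadic cube meeting the closure of
  \<open>E\<close> the function \<open>ln (dyadic_dist E Q0)\<close> lies in an interval of length \<open>c\<close> up to two exceptional
  sets of relative size at most \<open>s\<close>.\<close>

lemma ln_dyadic_dist_tails:
  fixes E Q0 :: "(real ^ 'n) set"
  assumes null: "closure E \<in> null_sets lebesgue"
    and C: "1 \<le> C" and s: "0 < s" "s * (1 + 2 ^ CARD('n)) < 1"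
    and ratio: "\<And>R. is_cube R \<Longrightarrow> R \<inter> closure E \<noteq> {} \<Longrightarrow>
      0 < upper_scale E s R / lower_scale E s R \<and> upper_scale E s R / lower_scale E s R \<le> ennreal C"
    and Q0: "is_cube Q0" "Q0 \<inter> closure E \<noteq> {}"
  obtains l where "0 < l"
    "\<And>k. emeasure lebesgue {x \<in> Q0 - closure E. ln (2 * C * l) + 2 * ln (4 * C) * real k < ln (dyadic_dist E Q0 x)}
      \<le> ennreal ((1/2) ^ k) * emeasure lebesgue Q0"
    "\<And>k. emeasure lebesgue {x \<in> Q0 - closure E. ln (dyadic_dist E Q0 x) < ln (l / 2) - 2 * ln (4 * C) * real k}
      \<le> ennreal ((1/2) ^ k) * emeasure lebesgue Q0"
proof -
  let ?d = "dyadic_dist E Q0"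
  define u where "u R = enn2real (upper_scale E s R)" for R
  define l where "l R = enn2real (lower_scale E s R)" for R
  have ul: "upper_scale E s R = ennreal (u R)" "lower_scale E s R = ennreal (l R)" "0 < u R" "0 < l R" "u R \<le> C * l R"
    if R: "is_cube R" "R \<inter> closure E \<noteq> {}" for R
  proof -
    obtain u' l' where "upper_scale E s R = ennreal u'" "lower_scale E s R = ennreal l'" "0 < u'" "0 < l'" "u' \<le> C * l'"
      using ratio[OF R] scale_ratio_cases by metis
    then show "upper_scale E s R = ennreal (u R)" "lower_scale E s R = ennreal (l R)" "0 < u R" "0 < l R" "u R \<le> C * l R"
      by (auto simp: u_def l_def)
  qed
  define g where "g x = ln (?d x)" for x
  \<comment> \<open>On a cube that misses the closure \<open>g\<close> is constant, and its value
    serves for both \<open>a\<close> and \<open>b\<close>. On the others the factors 1/2 and 2 move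
    strictly past the infimum and the supremum, where the measure bounds hold.\<close>
  define a where "a R = (if R \<inter> closure E = {} then g (SOME x. x \<in> R) else ln (l R / 2))" for R
  define b where "b R = (if R \<inter> closure E = {} then g (SOME x. x \<in> R) else ln (2 * u R))" for R
  \<comment> \<open>The quotient of \<open>2 * u R\<close> and \<open>l R / 2\<close> is at most
    \<open>4 * C\<close>.\<close>
  define c where "c = ln (4 * C)"
  have c: "0 \<le> c" using C by (simp add: c_def)
  have Q00: "Q0 \<in> dyadic 0 Q0" using dyadic_0[OF Q0(1)] by simp
  note [measurable] = dyadic_dist_measurable[OF Q0(1)]
  have g_meas: "g \<in> borel_measurable lebesgue" unfolding g_def by measurable
  have const: "a R = g x \<and> b R = g x" if "R \<in> dyadic j Q0" "R \<inter> closure E = {}" "x \<in> R" for R j x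
  proof -
    have "(SOME x. x \<in> R) \<in> R" using that(3) by (rule someI)
    then have "?d (SOME x. x \<in> R) = ?d x"
      using dyadic_dist_const[OF Q0 that(1,2)] that(3) by blast
    then show ?thesis using that(2) by (simp add: a_def b_def g_def)
  qed
  have upper: "emeasure lebesgue {x \<in> R - closure E. b R < g x} \<le> ennreal s * emeasure lebesgue R"
    if R: "R \<in> dyadic j Q0" for R j
  proof (cases "R \<inter> closure E = {}")
    case True
    then have empty: "{x \<in> R - closure E. b R < g x} = {}" using const[OF R True] by force
    show ?thesis unfolding empty by simp
  next
    case False
    note ulR = ul[OF is_cube_dyadic[OF R] False]
    have cR: "R \<in> sets lebesgue" "closure E \<in> sets lebesgue"
      using is_cube_sets[OF is_cube_dyadic[OF R]] null by auto
    have "emeasure lebesgue {x \<in> R - closure E. b R < g x} \<le> emeasure lebesgue {x \<in> R - closure E. 2 * u R \<le> ?d x}"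
    proof (rule emeasure_mono)
      show "{x \<in> R - closure E. b R < g x} \<subseteq> {x \<in> R - closure E. 2 * u R \<le> ?d x}"
      proof safe
        fix x assume x: "x \<in> R" "x \<notin> closure E" "b R < g x"
        have "0 < ?d x"
          using dyadic_dist_pos[OF Q0] x dyadic_subset[OF Q0(1) R] by blast
        then show "2 * u R \<le> ?d x" using x(3) False ulR(3) by (simp add: b_def g_def)
      qed
      show "{x \<in> R - closure E. 2 * u R \<le> ?d x} \<in> sets lebesgue"
        using cR by measurable
    qed
    also have "\<dots> \<le> ennreal s * emeasure lebesgue R"
      using ulR by (intro upper_scale_less[OF Q0(1) R False]) (auto intro: ennreal_lessI)
    finally show ?thesis .
  qed
  have lower: "emeasure lebesgue {x \<in> R - closure E. g x < a R} \<le> ennreal s * emeasure lebesgue R"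
    if R: "R \<in> dyadic j Q0" for R j
  proof (cases "R \<inter> closure E = {}")
    case True
    then have empty: "{x \<in> R - closure E. g x < a R} = {}" using const[OF R True] by force
    show ?thesis unfolding empty by simp
  next
    case False
    note ulR = ul[OF is_cube_dyadic[OF R] False]
    have cR: "R \<in> sets lebesgue" "closure E \<in> sets lebesgue"
      using is_cube_sets[OF is_cube_dyadic[OF R]] null by auto
    have "emeasure lebesgue {x \<in> R - closure E. g x < a R} \<le> emeasure lebesgue {x \<in> R - closure E. ?d x \<le> l R / 2}"
    proof (rule emeasure_mono)
      show "{x \<in> R - closure E. g x < a R} \<subseteq> {x \<in> R - closure E. ?d x \<le> l R / 2}"
      proof safe
        fix x assume x: "x \<in> R" "x \<notin> closure E" "g x < a R"
        have "0 < ?d x"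
          using dyadic_dist_pos[OF Q0] x dyadic_subset[OF Q0(1) R] by blast
        then show "?d x \<le> l R / 2" using x(3) False ulR(4) by (simp add: a_def g_def)
      qed
      show "{x \<in> R - closure E. ?d x \<le> l R / 2} \<in> sets lebesgue"
        using cR by measurable
    qed
    also have "\<dots> \<le> ennreal s * emeasure lebesgue R"
      using ulR by (intro lower_scale_greater[OF Q0(1) R False]) (auto intro: ennreal_lessI)
    finally show ?thesis .
  qed
  have ba: "b R \<le> a R + c" if R: "R \<in> dyadic j Q0" for R j
  proof (cases "R \<inter> closure E = {}")
    case True
    then show ?thesis using c by (simp add: a_def b_def)
  next
    case False
    note ulR = ul[OF is_cube_dyadic[OF R] False]
    have "ln (2 * u R) \<le> ln (l R / 2 * (4 * C))"
      using ulR C by (subst ln_le_cancel_iff) (auto simp: field_simps)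
    also have "\<dots> = ln (l R / 2) + c"
      using ulR(4) C unfolding c_def by (intro ln_mult_pos) auto
    finally show ?thesis using False by (simp add: a_def b_def)
  qed
  \<comment> \<open>Each point off the closure lies in a maximal avoiding cube, on which
    \<open>g\<close>, \<open>a\<close> and \<open>b\<close> agree. Equality with \<open>a\<close>
    serves the upper tail, equality with \<open>b\<close> the lower one.\<close>
  have cover: "\<exists>i. \<exists>S\<in>dyadic i R. x \<in> S \<and> a S = g x \<and> b S = g x"
    if R: "R \<in> dyadic j Q0" and x: "x \<in> R - closure E" for R j x
  proof (cases "R \<inter> closure E = {}")
    case True
    then show ?thesis
      using const[OF R True] x dyadic_0[OF is_cube_dyadic[OF R]] by (intro exI[of _ 0]) auto
  next
    case False
    have cR: "is_cube R" by (rule is_cube_dyadic[OF R])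
    obtain Q where Q: "Q \<in> dyadic_avoiding E R" "x \<in> Q"
      using dyadic_avoiding_cover[OF cR False x] by blast
    obtain i where i: "Q \<in> dyadic (Suc i) R" "Q \<inter> closure E = {}"
      by (rule dyadic_avoidingE[OF cR Q(1)])
    show ?thesis
      using const[OF dyadic_trans[OF i(1) R] i(2) Q(2)] i(1) Q(2) by blast
  qed
  note s0 = less_imp_le[OF s(1)]
  have JN1: "emeasure lebesgue {x \<in> Q0 - closure E. b Q0 + 2 * c * real k < g x} \<le> ennreal ((1/2) ^ k) * emeasure lebesgue Q0" for k
    using cover
    by (intro dyadic_John_Nirenberg[OF Q0(1) null g_meas s0 s(2) upper lower ba c _ Q00]) (assumption | metis order_refl)+
  \<comment> \<open>Reflection: for \<open>- g\<close> the levels \<open>- b\<close> and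
    \<open>- a\<close> take the parts of \<open>a\<close> and \<open>b\<close>, which turns the
    upper tail into the lower one.\<close>
  have JN2: "emeasure lebesgue {x \<in> Q0 - closure E. - a Q0 + 2 * c * real k < - g x} \<le> ennreal ((1/2) ^ k) * emeasure lebesgue Q0" for k
  proof (rule dyadic_John_Nirenberg[OF Q0(1) null _ s0 s(2) _ _ _ c _ Q00, where b = "\<lambda>R. - a R" and a = "\<lambda>R. - b R"])
    show "(\<lambda>x. - g x) \<in> borel_measurable lebesgue" using g_meas by measurable
    fix j R assume R: "R \<in> dyadic j Q0"
    show "emeasure lebesgue {x \<in> R - closure E. - a R < - g x} \<le> ennreal s * emeasure lebesgue R"
      using lower[OF R] by simp
    show "emeasure lebesgue {x \<in> R - closure E. - g x < - b R} \<le> ennreal s * emeasure lebesgue R"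
      using upper[OF R] by simp
    show "- a R \<le> - b R + c" using ba[OF R] by simp
    show "\<exists>i. \<exists>S\<in>dyadic i R. x \<in> S \<and> - g x \<le> - b S" if x: "x \<in> R - closure E" for x
    proof -
      obtain i S where "S \<in> dyadic i R" "x \<in> S" "b S = g x"
        using cover[OF R x] by blast
      then show ?thesis by (intro exI[of _ i] bexI[of _ S]) auto
    qed
  qed
  note ul0 = ul[OF Q0]
  have [measurable]: "Q0 \<in> sets lebesgue" "closure E \<in> sets lebesgue"
    using is_cube_sets[OF Q0(1)] null by auto
  show thesis
  proof (rule that[of "l Q0"])
    show "0 < l Q0" by (rule ul0(4))
    fix k
    \<comment> \<open>The bounded ratio at the root lets the single number \<open>l Q0\<close>
      locate both tails.\<close>
    have "ln (2 * u Q0) \<le> ln (2 * C * l Q0)"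
      using ul0 C by (subst ln_le_cancel_iff) (auto simp: mult.assoc)
    then have "{x \<in> Q0 - closure E. ln (2 * C * l Q0) + 2 * ln (4 * C) * real k < ln (?d x)}
        \<subseteq> {x \<in> Q0 - closure E. b Q0 + 2 * c * real k < g x}"
      using Q0(2) by (auto simp: b_def g_def c_def)
    then have "emeasure lebesgue {x \<in> Q0 - closure E. ln (2 * C * l Q0) + 2 * ln (4 * C) * real k < ln (?d x)}
        \<le> emeasure lebesgue {x \<in> Q0 - closure E. b Q0 + 2 * c * real k < g x}"
      by (rule emeasure_mono) (use g_meas in measurable)
    also note JN1[of k]
    finally show "emeasure lebesgue {x \<in> Q0 - closure E. ln (2 * C * l Q0) + 2 * ln (4 * C) * real k < ln (?d x)}
      \<le> ennreal ((1/2) ^ k) * emeasure lebesgue Q0" .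
    have "{x \<in> Q0 - closure E. ln (?d x) < ln (l Q0 / 2) - 2 * ln (4 * C) * real k}
        = {x \<in> Q0 - closure E. - a Q0 + 2 * c * real k < - g x}"
      using Q0(2) by (auto simp: a_def g_def c_def)
    with JN2[of k] show "emeasure lebesgue {x \<in> Q0 - closure E. ln (?d x) < ln (l Q0 / 2) - 2 * ln (4 * C) * real k}
      \<le> ennreal ((1/2) ^ k) * emeasure lebesgue Q0" by simp
  qed
qed

lemma emeasure_small_set_split:
  assumes "A \<subseteq> B1 \<union> B2" "B1 \<in> sets M" "B2 \<in> sets M"
    "emeasure M B1 \<le> ennreal b1 * m" "emeasure M B2 \<le> ennreal b2 * m" "0 \<le> b1" "0 \<le> b2"
  shows "emeasure M A \<le> ennreal (b1 + b2) * m"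
proof -
  have "emeasure M A \<le> emeasure M (B1 \<union> B2)"
    using assms by (intro emeasure_mono) auto
  also have "\<dots> \<le> emeasure M B1 + emeasure M B2"
    using assms by (intro emeasure_subadditive)
  also have "\<dots> \<le> ennreal b1 * m + ennreal b2 * m"
    using assms by (intro add_mono)
  finally show ?thesis
    using assms by (simp add: ennreal_plus distrib_right)
qed

section \<open>Integrals of small powers of the distance\<close>

lemma nn_integral_Diff_null_set:
  assumes "N \<in> null_sets M"
  shows "(\<integral>\<^sup>+x\<in>A. F x \<partial>M) = (\<integral>\<^sup>+x\<in>A - N. F x \<partial>M)"
  by (rule nn_integral_cong_AE, rule eventually_mono[OF AE_not_in[OF assms]]) (auto simp: indicator_def)

text \<open>Off the closure the power equals \<open>r powr t * exp (t * (ln d - ln r))\<close> for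
  the distance \<open>d\<close>. The null set where \<open>d = 0\<close> is cut out first, because
  \<open>exp\<close> of a logarithm does not reproduce an infinite power there.\<close>

lemma nn_integral_infdist_powr_le:
  fixes E Q :: "(real ^ 'n) set"
  assumes E: "E \<noteq> {}" and null: "closure E \<in> null_sets lebesgue" and Q: "Q \<in> sets lebesgue"
    and pos: "0 < r" "0 \<le> B"
    and le: "(\<integral>\<^sup>+x\<in>Q - closure E. ennreal (exp (t * (ln (infdist x E) - ln r))) \<partial>lebesgue) \<le> ennreal B"
  shows "(\<integral>\<^sup>+x\<in>Q. epowr (ennreal (infdist x E)) t \<partial>lebesgue) \<le> ennreal (r powr t * B)"
proof -
  have [measurable]: "Q \<in> sets lebesgue" "closure E \<in> sets lebesgue"
    using Q null by auto
  have eq: "epowr (ennreal (infdist x E)) t * indicator (Q - closure E) x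
      = ennreal (r powr t) * (ennreal (exp (t * (ln (infdist x E) - ln r))) * indicator (Q - closure E) x)" for x
  proof (cases "x \<in> Q - closure E")
    case True
    then have d: "0 < infdist x E"
      using in_closure_iff_infdist_zero[OF E, of x] infdist_nonneg[of x E] by auto
    have "infdist x E powr t = r powr t * exp (t * (ln (infdist x E) - ln r))"
      using d pos by (simp add: powr_def exp_add[symmetric] algebra_simps)
    with True d show ?thesis
      by (simp add: epowr_ennreal ennreal_mult)
  qed simp
  have "(\<integral>\<^sup>+x\<in>Q. epowr (ennreal (infdist x E)) t \<partial>lebesgue)
      = (\<integral>\<^sup>+x\<in>Q - closure E. epowr (ennreal (infdist x E)) t \<partial>lebesgue)"
    by (rule nn_integral_Diff_null_set[OF null])
  also have "\<dots> = ennreal (r powr t) *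
      (\<integral>\<^sup>+x\<in>Q - closure E. ennreal (exp (t * (ln (infdist x E) - ln r))) \<partial>lebesgue)"
    unfolding eq by (rule nn_integral_cmult) measurable
  also have "\<dots> \<le> ennreal (r powr t) * ennreal B"
    by (intro mult_left_mono le) simp
  finally show ?thesis
    using pos by (simp add: ennreal_mult)
qed

text \<open>The tails of the dyadic distance pass to the true distance with step
  \<open>4 * c\<close>, where \<open>c = ln (4 * C)\<close>, and ratio 1/2. The smallness of
  \<open>\<gamma>\<close> is the convergence of the resulting geometric series.\<close>

lemma infdist_powr_integrals:
  fixes E Q0 :: "(real ^ 'n) set"
  assumes E: "E \<noteq> {}" and null: "closure E \<in> null_sets lebesgue" and Q0: "is_cube Q0" "Q0 \<inter> closure E \<noteq> {}"
    and C: "1 \<le> C" and l: "0 < l"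
    and up: "\<And>k. emeasure lebesgue {x \<in> Q0 - closure E. ln (2 * C * l) + 2 * ln (4 * C) * real k < ln (dyadic_dist E Q0 x)}
      \<le> ennreal ((1/2) ^ k) * emeasure lebesgue Q0"
    and low: "\<And>k. emeasure lebesgue {x \<in> Q0 - closure E. ln (dyadic_dist E Q0 x) < ln (l / 2) - 2 * ln (4 * C) * real k}
      \<le> ennreal ((1/2) ^ k) * emeasure lebesgue Q0"
    and n: "n = real CARD('n)" and m: "emeasure lebesgue Q0 = ennreal m" "0 \<le> m"
    and \<gamma>: "0 < \<gamma>" "exp (\<gamma> * (4 * ln (4 * C))) < 2"
  shows "(\<integral>\<^sup>+x\<in>Q0. epowr (ennreal (infdist x E)) (- \<gamma>) \<partial>lebesgue)
      \<le> ennreal ((l / 2) powr (- \<gamma>) * ((1 + (1 + 2 * n) * exp (\<gamma> * (4 * ln (4 * C))) / (1 - exp (\<gamma> * (4 * ln (4 * C))) * (1 / 2))) * m))" (is ?A)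
    and "(\<integral>\<^sup>+x\<in>Q0. epowr (ennreal (infdist x E)) \<gamma> \<partial>lebesgue)
      \<le> ennreal ((4 * n * C * l) powr \<gamma> * ((1 + (1 + 2 * n) * exp (\<gamma> * (4 * ln (4 * C))) / (1 - exp (\<gamma> * (4 * ln (4 * C))) * (1 / 2))) * m))" (is ?B)
proof -
  let ?d = "dyadic_dist E Q0" and ?W = "Q0 - closure E"
  define c where "c = ln (4 * C)"
  have n0: "0 < n" by (simp add: n)
  have c: "0 < c" using C by (simp add: c_def)
  have [measurable]: "Q0 \<in> sets lebesgue" "closure E \<in> sets lebesgue" "?d \<in> borel_measurable lebesgue"
    using is_cube_sets[OF Q0(1)] null dyadic_dist_measurable[OF Q0(1)] by auto
  have W: "emeasure lebesgue ?W \<le> ennreal m"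
    unfolding m(1)[symmetric] by (rule emeasure_mono) auto
  have dpos: "0 < infdist x E" if "x \<in> ?W" for x
    using that in_closure_iff_infdist_zero[OF E, of x] infdist_nonneg[of x E] by auto
  have small: "exp (\<gamma> * (4 * c)) * (1 / 2) < 1" "0 \<le> \<gamma>" using \<gamma> by (simp_all add: c_def)
  have K: "0 \<le> (1 + (1 + 2 * n) * exp (\<gamma> * (4 * c)) / (1 - exp (\<gamma> * (4 * c)) * (1 / 2))) * m"
    using small n0 m by (intro mult_nonneg_nonneg add_nonneg_nonneg divide_nonneg_nonneg) auto
  \<comment> \<open>A deviation of \<open>4 * c * k\<close> is split evenly: either the dyadic
    distance is already too small by \<open>2 * c * k\<close> on the logarithmic scale, or the point
    lies in a boundary layer of relative width \<open>exp (- (2 * c * k))\<close>. The layers decay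
    at least like \<open>(1/2) ^ k\<close> because \<open>c \<ge> ln 2\<close>.\<close>
  have tail1: "emeasure lebesgue {x \<in> ?W. 4 * c * real k < ln (l / 2) - ln (infdist x E)}
      \<le> ennreal ((1 + 2 * n) * (1 / 2) ^ k * m)" for k
  proof -
    let ?q = "exp (- (2 * c * real k))"
    have q: "?q \<le> (1 / 2) ^ k"
    proof -
      have "ln 2 \<le> c" using C unfolding c_def by (subst ln_le_cancel_iff) auto
      then have "exp (- (2 * c)) \<le> exp (- ln 2)" using c by simp
      also have "\<dots> = 1 / 2" by (simp add: exp_minus)
      finally have "exp (- (2 * c)) ^ k \<le> (1 / 2) ^ k" by (rule power_mono) simp
      moreover have "exp (- (2 * c)) ^ k = ?q" by (simp add: exp_of_nat_mult[symmetric] mult_ac)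
      ultimately show ?thesis by simp
    qed
    let ?B1 = "{x \<in> ?W. ln (?d x) < ln (l / 2) - 2 * c * real k}"
    let ?B2 = "{x \<in> \<Union>(dyadic_avoiding E Q0). infdist x E < ?q * ?d x}"
    have sub: "{x \<in> ?W. 4 * c * real k < ln (l / 2) - ln (infdist x E)} \<subseteq> ?B1 \<union> ?B2"
    proof
      fix x assume "x \<in> {x \<in> ?W. 4 * c * real k < ln (l / 2) - ln (infdist x E)}"
      then have x: "x \<in> ?W" "4 * c * real k < ln (l / 2) - ln (infdist x E)" by auto
      show "x \<in> ?B1 \<union> ?B2"
      proof (rule ccontr)
        assume "x \<notin> ?B1 \<union> ?B2"
        then have *: "ln (l / 2) - 2 * c * real k \<le> ln (?d x)" "?q * ?d x \<le> infdist x E"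
          using x(1) Union_dyadic_avoiding[OF Q0] by auto
        have "ln (?q * ?d x) \<le> ln (infdist x E)"
          using *(2) dyadic_dist_pos[OF Q0 x(1)] dpos[OF x(1)] by (subst ln_le_cancel_iff) auto
        then have "ln (?d x) - 2 * c * real k \<le> ln (infdist x E)"
          using dyadic_dist_pos[OF Q0 x(1)] by (simp add: ln_mult_pos)
        with *(1) x(2) show False by simp
      qed
    qed
    have "emeasure lebesgue ?B2 \<le> ennreal (2 * n * ?q) * emeasure lebesgue (\<Union>(dyadic_avoiding E Q0))"
      unfolding n by (rule emeasure_infdist_less_dyadic_dist[OF E Q0(1)]) auto
    also have "\<dots> \<le> ennreal (2 * n * (1 / 2) ^ k) * ennreal m"
      using q n0 W by (intro mult_mono ennreal_leI) (auto simp: Union_dyadic_avoiding[OF Q0])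
    finally have B2: "emeasure lebesgue ?B2 \<le> ennreal (2 * n * (1 / 2) ^ k) * ennreal m" .
    have "emeasure lebesgue {x \<in> ?W. 4 * c * real k < ln (l / 2) - ln (infdist x E)}
        \<le> ennreal ((1 / 2) ^ k + 2 * n * (1 / 2) ^ k) * ennreal m"
    proof (rule emeasure_small_set_split[OF sub _ _ _ B2])
      show "?B1 \<in> sets lebesgue" by measurable
      show "?B2 \<in> sets lebesgue" unfolding Union_dyadic_avoiding[OF Q0] by measurable
      show "emeasure lebesgue ?B1 \<le> ennreal ((1 / 2) ^ k) * ennreal m"
        using low[of k] by (simp add: m(1) c_def)
    qed (use n0 in auto)
    also have "\<dots> = ennreal ((1 + 2 * n) * (1 / 2) ^ k * m)"
      using n0 m(2) by (subst ennreal_mult[symmetric]) (auto simp: algebra_simps)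
    finally show ?thesis .
  qed
  have "(\<integral>\<^sup>+x\<in>?W. ennreal (exp (\<gamma> * (ln (l / 2) - ln (infdist x E)))) \<partial>lebesgue)
      \<le> ennreal ((1 + (1 + 2 * n) * exp (\<gamma> * (4 * c)) / (1 - exp (\<gamma> * (4 * c)) * (1 / 2))) * m)"
    using c n0 by (intro nn_integral_exp_le_of_tail[OF _ _ _ small(2) _ _ m(2) small(1) W tail1]) auto
  then have "(\<integral>\<^sup>+x\<in>?W. ennreal (exp (- \<gamma> * (ln (infdist x E) - ln (l / 2)))) \<partial>lebesgue)
      \<le> ennreal ((1 + (1 + 2 * n) * exp (\<gamma> * (4 * c)) / (1 - exp (\<gamma> * (4 * c)) * (1 / 2))) * m)"
    by (simp add: algebra_simps)
  then show ?A
    unfolding c_def[symmetric]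
    by (rule nn_integral_infdist_powr_le[OF E null _ _ K, rotated 2]) (use l in auto)
  \<comment> \<open>This side has no boundary layers, since the distance is at most
    \<open>2 * n\<close> times the dyadic one everywhere off the closure;
    \<open>4 * n * C * l\<close> is \<open>2 * n\<close> times \<open>2 * C * l\<close>.\<close>
  have tail2: "emeasure lebesgue {x \<in> ?W. 4 * c * real k < ln (infdist x E) - ln (4 * n * C * l)}
      \<le> ennreal ((1 + 2 * n) * (1 / 2) ^ k * m)" for k
  proof -
    have "{x \<in> ?W. 4 * c * real k < ln (infdist x E) - ln (4 * n * C * l)}
      \<subseteq> {x \<in> ?W. ln (2 * C * l) + 2 * c * real k < ln (?d x)}"
    proof safe
      fix x assume x: "x \<in> Q0" "x \<notin> closure E" "4 * c * real k < ln (infdist x E) - ln (4 * n * C * l)"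
      then have xW: "x \<in> ?W" by simp
      have "infdist x E \<le> 2 * n * ?d x"
        using infdist_le_dyadic_dist[OF Q0 xW] by (simp add: n)
      then have "ln (infdist x E) \<le> ln (2 * n * ?d x)"
        using dpos[OF xW] dyadic_dist_pos[OF Q0 xW] n0 by (subst ln_le_cancel_iff) auto
      also have "\<dots> = ln (2 * n) + ln (?d x)"
        using dyadic_dist_pos[OF Q0 xW] n0 by (intro ln_mult_pos) auto
      finally have "ln (infdist x E) \<le> ln (2 * n) + ln (?d x)" .
      moreover have "ln (4 * n * C * l) = ln (2 * n) + ln (2 * C * l)"
        using n0 C l by (subst ln_mult_pos[symmetric]) (auto simp: mult_ac)
      moreover have "0 \<le> 2 * c * real k" using c by simp
      ultimately show "ln (2 * C * l) + 2 * c * real k < ln (?d x)" using x(3) by simp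
    qed
    then have "emeasure lebesgue {x \<in> ?W. 4 * c * real k < ln (infdist x E) - ln (4 * n * C * l)}
        \<le> emeasure lebesgue {x \<in> ?W. ln (2 * C * l) + 2 * c * real k < ln (?d x)}"
      by (rule emeasure_mono) measurable
    also have "\<dots> \<le> ennreal ((1 / 2) ^ k) * ennreal m"
      using up[of k] by (simp add: m(1) c_def)
    also have "\<dots> = ennreal ((1 / 2) ^ k * m)" using m(2) by (subst ennreal_mult) auto
    \<comment> \<open>Weakened so that both integrals carry a constant of the same form.\<close>
    also have "\<dots> \<le> ennreal ((1 + 2 * n) * ((1 / 2) ^ k * m))"
      using n0 m(2) mult_right_mono[of 1 "1 + 2 * n" "(1 / 2) ^ k * m"] by (intro ennreal_leI) simp
    finally show ?thesis by (simp only: mult.assoc)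
  qed
  have "(\<integral>\<^sup>+x\<in>?W. ennreal (exp (\<gamma> * (ln (infdist x E) - ln (4 * n * C * l)))) \<partial>lebesgue)
      \<le> ennreal ((1 + (1 + 2 * n) * exp (\<gamma> * (4 * c)) / (1 - exp (\<gamma> * (4 * c)) * (1 / 2))) * m)"
    using c n0 by (intro nn_integral_exp_le_of_tail[OF _ _ _ small(2) _ _ m(2) small(1) W tail2]) auto
  then show ?B
    unfolding c_def[symmetric]
    by (rule nn_integral_infdist_powr_le[OF E null _ _ K, rotated 2]) (use l n0 C in auto)
qed

text \<open>The number \<open>r\<close> is a typical size of the distance on \<open>Q\<close>,
  common to both integrals, so that its powers can cancel in a Muckenhoupt product. The exponents
  \<open>\<alpha>\<close> and \<open>\<beta>\<close> are independent because the dual exponent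
  depends on \<open>p\<close>.\<close>

lemma infdist_powr_integrals_cube:
  fixes E :: "(real ^ 'n) set"
  assumes E: "E \<noteq> {}" and null: "closure E \<in> null_sets lebesgue"
    and C: "1 \<le> C" and s: "0 < s" "s * (1 + 2 ^ CARD('n)) < 1"
    and ratio: "\<And>R. is_cube R \<Longrightarrow> R \<inter> closure E \<noteq> {} \<Longrightarrow>
      0 < upper_scale E s R / lower_scale E s R \<and> upper_scale E s R / lower_scale E s R \<le> ennreal C"
    and \<alpha>: "0 < \<alpha>" "exp (\<alpha> * (4 * ln (4 * C))) < 2" and \<beta>: "0 < \<beta>" "exp (\<beta> * (4 * ln (4 * C))) < 2"
  obtains K where "0 < K" "\<And>Q. is_cube Q \<Longrightarrow> \<exists>r>0.
    (\<integral>\<^sup>+x\<in>Q. epowr (ennreal (infdist x E)) (- \<alpha>) \<partial>lebesgue) \<le> ennreal (K * r powr (- \<alpha>) * side Q ^ CARD('n)) \<and>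
    (\<integral>\<^sup>+x\<in>Q. epowr (ennreal (infdist x E)) \<beta> \<partial>lebesgue) \<le> ennreal (K * r powr \<beta> * side Q ^ CARD('n))"
proof -
  define n where "n = real CARD('n)"
  have n0: "0 < n" by (simp add: n_def)
  define K0 where "K0 \<gamma> = 1 + (1 + 2 * n) * exp (\<gamma> * (4 * ln (4 * C))) / (1 - exp (\<gamma> * (4 * ln (4 * C))) * (1 / 2))" for \<gamma>
  have K0: "0 < K0 \<alpha>" "0 < K0 \<beta>"
    using \<alpha> \<beta> n0 by (auto simp: K0_def intro!: add_pos_nonneg divide_nonneg_nonneg)
  define K1 where "K1 = 2 powr \<alpha> * K0 \<alpha> + (4 * n * C) powr \<beta> * K0 \<beta>"
  \<comment> \<open>The first summand pays for enlarging \<open>Q\<close> to its triple, the other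
    two for the oscillation of the distance on a cube whose triple misses the closure.\<close>
  define K where "K = 3 ^ CARD('n) * K1 + (1 + n) powr \<alpha> + (1 + n) powr \<beta>"
  have K1: "0 < K1" using K0 n0 C by (auto simp: K1_def intro!: add_pos_pos mult_pos_pos)
  then have K: "0 < K" using n0 by (auto simp: K_def intro!: add_pos_pos)
  have meets: "\<exists>r>0.
    (\<integral>\<^sup>+x\<in>Q. epowr (ennreal (infdist x E)) (- \<alpha>) \<partial>lebesgue) \<le> ennreal (K1 * r powr (- \<alpha>) * side Q ^ CARD('n)) \<and>
    (\<integral>\<^sup>+x\<in>Q. epowr (ennreal (infdist x E)) \<beta> \<partial>lebesgue) \<le> ennreal (K1 * r powr \<beta> * side Q ^ CARD('n))"
    if Q: "is_cube Q" "Q \<inter> closure E \<noteq> {}" for Q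
  proof -
    have m: "emeasure lebesgue Q = ennreal (side Q ^ CARD('n))" "0 \<le> side Q ^ CARD('n)"
      using emeasure_is_cube[OF Q(1)] side_pos[OF Q(1)] by auto
    obtain l where l: "0 < l"
      "\<And>k. emeasure lebesgue {x \<in> Q - closure E. ln (2 * C * l) + 2 * ln (4 * C) * real k < ln (dyadic_dist E Q x)}
        \<le> ennreal ((1/2) ^ k) * emeasure lebesgue Q"
      "\<And>k. emeasure lebesgue {x \<in> Q - closure E. ln (dyadic_dist E Q x) < ln (l / 2) - 2 * ln (4 * C) * real k}
        \<le> ennreal ((1/2) ^ k) * emeasure lebesgue Q"
      using ln_dyadic_dist_tails[OF null C s ratio Q] by blast
    note ints = infdist_powr_integrals[OF E null Q C l n_def m, folded K0_def]
    show ?thesis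
    proof (intro exI[of _ l] conjI l(1))
      have "(l / 2) powr (- \<alpha>) * (K0 \<alpha> * side Q ^ CARD('n)) = (2 powr \<alpha> * K0 \<alpha>) * (l powr (- \<alpha>) * side Q ^ CARD('n))"
        using l(1) by (simp add: powr_divide powr_minus_divide)
      also have "\<dots> \<le> K1 * (l powr (- \<alpha>) * side Q ^ CARD('n))"
        using K0 m(2) by (intro mult_right_mono) (auto simp: K1_def)
      finally show "(\<integral>\<^sup>+x\<in>Q. epowr (ennreal (infdist x E)) (- \<alpha>) \<partial>lebesgue) \<le> ennreal (K1 * l powr (- \<alpha>) * side Q ^ CARD('n))"
        unfolding mult.assoc by (intro order_trans[OF ints(1)[OF \<alpha>]] ennreal_leI)
      have "(4 * n * C * l) powr \<beta> * (K0 \<beta> * side Q ^ CARD('n)) = ((4 * n * C) powr \<beta> * K0 \<beta>) * (l powr \<beta> * side Q ^ CARD('n))"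
        using l(1) n0 C by (simp add: powr_mult)
      also have "\<dots> \<le> K1 * (l powr \<beta> * side Q ^ CARD('n))"
        using K0 m(2) by (intro mult_right_mono) (auto simp: K1_def)
      finally show "(\<integral>\<^sup>+x\<in>Q. epowr (ennreal (infdist x E)) \<beta> \<partial>lebesgue) \<le> ennreal (K1 * l powr \<beta> * side Q ^ CARD('n))"
        unfolding mult.assoc by (intro order_trans[OF ints(2)[OF \<beta>, unfolded mult.assoc]] ennreal_leI)
    qed
  qed
  show thesis
  proof (rule that[OF K])
    fix Q :: "(real ^ 'n) set" assume Q: "is_cube Q"
    then obtain b h where h: "0 < h" and Qb: "Q = cube b h" by (auto simp: is_cube_def)
    have side: "side Q = h" using h by (simp add: Qb side_cube)
    let ?T = "cube (b - (\<chi> i. h)) (3 * h)"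
    have T: "is_cube ?T" "side ?T = 3 * h"
      using h by (auto simp: is_cubeI side_cube)
    have QT: "Q \<subseteq> ?T"
    proof
      fix x assume "x \<in> Q"
      then have "b $ i \<le> x $ i \<and> x $ i < b $ i + h" for i by (simp add: Qb cube_def)
      then have "b $ i - h \<le> x $ i \<and> x $ i < b $ i - h + 3 * h" for i
        using h by (smt (verit))
      then show "x \<in> ?T" by (simp add: cube_def)
    qed
    show "\<exists>r>0.
      (\<integral>\<^sup>+x\<in>Q. epowr (ennreal (infdist x E)) (- \<alpha>) \<partial>lebesgue) \<le> ennreal (K * r powr (- \<alpha>) * side Q ^ CARD('n)) \<and>
      (\<integral>\<^sup>+x\<in>Q. epowr (ennreal (infdist x E)) \<beta> \<partial>lebesgue) \<le> ennreal (K * r powr \<beta> * side Q ^ CARD('n))"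
    proof (cases "?T \<inter> closure E = {}")
      case False
      then obtain r where r: "0 < r"
        "(\<integral>\<^sup>+x\<in>?T. epowr (ennreal (infdist x E)) (- \<alpha>) \<partial>lebesgue) \<le> ennreal (K1 * r powr (- \<alpha>) * (3 * h) ^ CARD('n))"
        "(\<integral>\<^sup>+x\<in>?T. epowr (ennreal (infdist x E)) \<beta> \<partial>lebesgue) \<le> ennreal (K1 * r powr \<beta> * (3 * h) ^ CARD('n))"
        using meets[OF T(1)] T(2) by auto
      have mono: "(\<integral>\<^sup>+x\<in>Q. F x \<partial>lebesgue) \<le> (\<integral>\<^sup>+x\<in>?T. F x \<partial>lebesgue)" for F
        using QT by (intro nn_integral_mono) (auto simp: indicator_def)
      have bound: "K1 * v * (3 * h) ^ CARD('n) \<le> K * v * side Q ^ CARD('n)" if "0 \<le> v" for v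
      proof -
        have "K1 * v * (3 * h) ^ CARD('n) = (3 ^ CARD('n) * K1) * (v * h ^ CARD('n))"
          by (simp add: power_mult_distrib)
        also have "\<dots> \<le> K * (v * h ^ CARD('n))"
          using that h by (intro mult_right_mono) (auto simp: K_def)
        finally show ?thesis by (simp add: side)
      qed
      show ?thesis
        using r by (intro exI[of _ r] conjI order_trans[OF mono] order_trans[OF r(2)] order_trans[OF r(3)]
          ennreal_leI bound) auto
    next
      case True
      have bQ: "b \<in> Q" using h by (simp add: Qb cube_def)
      have far: "h \<le> infdist x E" if x: "x \<in> Q" for x
      proof -
        have "h \<le> dist x y" if y: "y \<in> E" for y
        proof -
          have "y \<notin> ?T" using True y closure_subset[of E] by blast
          then obtain i where "y $ i < b $ i - h \<or> b $ i - h + 3 * h \<le> y $ i"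
            by (auto simp: cube_def not_le not_less)
          moreover have "b $ i \<le> x $ i" "x $ i < b $ i + h"
            using x by (auto simp: Qb cube_def)
          ultimately have "h \<le> \<bar>(x - y) $ i\<bar>" by auto
          also have "\<dots> \<le> dist x y" unfolding dist_norm by (rule component_le_norm_cart)
          finally show ?thesis .
        qed
        then show ?thesis
          using E by (auto simp: infdist_notempty intro!: cINF_greatest)
      qed
      define D where "D = infdist b E"
      have D: "0 < D" using far[OF bQ] h by (simp add: D_def)
      \<comment> \<open>The distance varies by at most \<open>n * h\<close> on \<open>Q\<close>, and
        \<open>h\<close> is bounded by both \<open>infdist x E\<close> and \<open>D\<close>.\<close>
      have close: "D / (1 + n) \<le> infdist x E \<and> infdist x E \<le> (1 + n) * D" if x: "x \<in> Q" for x
      proof -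
        have "dist x b \<le> n * h"
          using dist_is_cube_le[OF Q x bQ] by (simp add: n_def side)
        moreover have "\<bar>infdist x E - D\<bar> \<le> dist x b"
          unfolding D_def by (rule infdist_triangle_abs)
        moreover have "n * h \<le> n * infdist x E" "n * h \<le> n * D"
          using far[OF x] far[OF bQ] n0 by (auto simp: D_def)
        ultimately have "D \<le> (1 + n) * infdist x E" "infdist x E \<le> (1 + n) * D"
          by (auto simp: algebra_simps)
        then show ?thesis using n0 by (simp add: field_simps)
      qed
      have mQ: "emeasure lebesgue Q = ennreal (h ^ CARD('n))"
        using emeasure_is_cube[OF Q] by (simp add: side)
      have bound: "(\<integral>\<^sup>+x\<in>Q. F x \<partial>lebesgue) \<le> ennreal (K * v * side Q ^ CARD('n))"
        if F: "\<And>x. x \<in> Q \<Longrightarrow> F x \<le> ennreal (k * v)" and k: "0 \<le> k" "k \<le> K" "0 \<le> v" for F k v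
      proof -
        have "(\<integral>\<^sup>+x\<in>Q. F x \<partial>lebesgue) \<le> (\<integral>\<^sup>+x. ennreal (k * v) * indicator Q x \<partial>lebesgue)"
          using F by (intro nn_integral_mono) (auto simp: indicator_def)
        also have "\<dots> = ennreal (k * v) * emeasure lebesgue Q"
          by (rule nn_integral_cmult_indicator[OF is_cube_sets[OF Q]])
        also have "\<dots> = ennreal (k * v * h ^ CARD('n))"
          unfolding mQ using k h by (intro ennreal_mult[symmetric]) auto
        also have "\<dots> \<le> ennreal (K * v * side Q ^ CARD('n))"
          unfolding side using k h by (intro ennreal_leI mult_right_mono) auto
        finally show ?thesis .
      qed
      have kK: "(1 + n) powr \<alpha> \<le> K" "(1 + n) powr \<beta> \<le> K"
        using K1 by (auto simp: K_def)
      show ?thesis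
      proof (intro exI[of _ D] conjI D)
        show "(\<integral>\<^sup>+x\<in>Q. epowr (ennreal (infdist x E)) (- \<alpha>) \<partial>lebesgue) \<le> ennreal (K * D powr (- \<alpha>) * side Q ^ CARD('n))"
        proof (rule bound[OF _ _ kK(1)])
          fix x assume x: "x \<in> Q"
          have "0 < infdist x E" using far[OF x] h by simp
          then have "epowr (ennreal (infdist x E)) (- \<alpha>) = ennreal (infdist x E powr (- \<alpha>))"
            by (rule epowr_ennreal)
          also have "\<dots> \<le> ennreal ((D / (1 + n)) powr (- \<alpha>))"
            using close[OF x] D n0 \<alpha>(1) by (intro ennreal_leI powr_mono2') auto
          also have "(D / (1 + n)) powr (- \<alpha>) = (1 + n) powr \<alpha> * D powr (- \<alpha>)"
            using D n0 by (simp add: powr_divide powr_minus_divide)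
          finally show "epowr (ennreal (infdist x E)) (- \<alpha>) \<le> ennreal ((1 + n) powr \<alpha> * D powr (- \<alpha>))" .
        qed auto
        show "(\<integral>\<^sup>+x\<in>Q. epowr (ennreal (infdist x E)) \<beta> \<partial>lebesgue) \<le> ennreal (K * D powr \<beta> * side Q ^ CARD('n))"
        proof (rule bound[OF _ _ kK(2)])
          fix x assume x: "x \<in> Q"
          have "0 < infdist x E" using far[OF x] h by simp
          then have "epowr (ennreal (infdist x E)) \<beta> = ennreal (infdist x E powr \<beta>)"
            by (rule epowr_ennreal)
          also have "\<dots> \<le> ennreal (((1 + n) * D) powr \<beta>)"
            using close[OF x] D n0 \<beta>(1) infdist_nonneg by (intro ennreal_leI powr_mono2) auto
          also have "((1 + n) * D) powr \<beta> = (1 + n) powr \<beta> * D powr \<beta>"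
            using D n0 by (simp add: powr_mult)
          finally show "epowr (ennreal (infdist x E)) \<beta> \<le> ennreal ((1 + n) powr \<beta> * D powr \<beta>)" .
        qed auto
      qed
    qed
  qed
qed

lemma epowr_le:
  assumes "A \<le> ennreal B" "0 < t" "0 \<le> B"
  shows "epowr A t \<le> ennreal (B powr t)"
proof -
  obtain a where a: "A = ennreal a" "0 \<le> a"
    using assms(1) by (cases A) (auto simp: top_unique)
  then have "a \<le> B" using assms by simp
  show ?thesis
  proof (cases "a = 0")
    case True
    then show ?thesis using a assms(2) by (simp add: epowr_def)
  next
    case False
    then show ?thesis
      using a assms(2) \<open>a \<le> B\<close> by (simp add: epowr_ennreal less_le powr_mono2 ennreal_leI)
  qed
qed

lemma average_le:
  assumes "I \<le> ennreal (k * m)" "0 < m" "0 \<le> k"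
  shows "I / ennreal m \<le> ennreal k"
  using assms by (intro divide_le_posI_ennreal) (auto simp: ennreal_mult mult.commute)

section \<open>The Muckenhoupt condition for a negative power of the distance\<close>

text \<open>The exponent is \<open>\<theta> = - \<alpha>\<close> with small \<open>\<alpha>\<close>.
  The dual weight is then the power \<open>\<beta> = \<alpha> / (p - 1)\<close>, and both exponents
  must be small enough for exponential integrability.\<close>

lemma scale_bound_imp_Muckenhoupt:
  fixes E :: "(real ^ 'n) set"
  assumes E: "E \<noteq> {}" and s: "0 < s" "s < inverse (1 + 2 ^ CARD('n))"
    and ratio: "\<And>R. is_cube R \<Longrightarrow> R \<inter> closure E \<noteq> {} \<Longrightarrow>
      0 < upper_scale E s R / lower_scale E s R \<and> upper_scale E s R / lower_scale E s R \<le> ennreal C0"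
    and p: "1 < p"
  shows "\<exists>\<theta>. \<theta> \<noteq> 0 \<and> (\<lambda>x. epowr (ennreal (infdist x E)) \<theta>) \<in> Muckenhoupt p"
proof -
  \<comment> \<open>Enlarging the constant to at least 1 makes \<open>ln (4 * C)\<close> at least
    \<open>ln 2\<close>, as the tail estimates require.\<close>
  define C where "C = max C0 1"
  have C: "1 \<le> C" by (simp add: C_def)
  have ratio': "0 < upper_scale E s R / lower_scale E s R \<and> upper_scale E s R / lower_scale E s R \<le> ennreal C"
    if R: "is_cube R" "R \<inter> closure E \<noteq> {}" for R
    using ratio[OF R] by (auto simp: C_def elim!: order_trans intro!: ennreal_leI)
  have pow: "(0 :: real) < 2 ^ CARD('n)" by simp
  have s': "s * (1 + 2 ^ CARD('n)) < 1"
    using s(2) pow by (simp add: field_simps)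
  have "s * 1 \<le> s * (1 + 2 ^ CARD('n))" using s(1) by (intro mult_left_mono) auto
  then have s1: "s < 1" using s' by linarith
  have null: "closure E \<in> null_sets lebesgue"
    using ratio by (intro null_sets_closure_of_upper_scale[OF s(1) s1]) (simp add: ennreal_zero_less_divide)
  define c where "c = ln (4 * C)"
  have c: "0 < c" using C by (simp add: c_def)
  \<comment> \<open>The minimum keeps both \<open>\<alpha>\<close> and
    \<open>\<alpha> / (p - 1)\<close> below \<open>ln 2 / (8 * c)\<close>; then
    \<open>exp (4 * c * \<gamma>)\<close> is at most the square root of 2 for either exponent
    \<open>\<gamma>\<close>.\<close>
  define \<alpha> where "\<alpha> = min 1 (p - 1) * (ln 2 / (8 * c))"
  define t where "t = p - 1"
  define \<beta> where "\<beta> = \<alpha> / t"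
  have t: "0 < t" using p by (simp add: t_def)
  have \<alpha>0: "0 < \<alpha>" using p c by (simp add: \<alpha>_def)
  have \<beta>0: "0 < \<beta>" using \<alpha>0 t by (simp add: \<beta>_def)
  have small: "exp (\<gamma> * (4 * c)) < 2" if "\<gamma> \<le> ln 2 / (8 * c)" for \<gamma>
  proof -
    have "\<gamma> * (4 * c) \<le> ln 2 / (8 * c) * (4 * c)" using that c by (intro mult_right_mono) auto
    also have "\<dots> < ln 2" using c by simp
    finally have "exp (\<gamma> * (4 * c)) < exp (ln 2)" by (simp only: exp_less_cancel_iff)
    then show ?thesis by simp
  qed
  have "\<alpha> \<le> 1 * (ln 2 / (8 * c))" unfolding \<alpha>_def using c by (intro mult_right_mono) auto
  then have \<alpha>2: "exp (\<alpha> * (4 * c)) < 2" by (intro small) simp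
  have "\<alpha> \<le> t * (ln 2 / (8 * c))" unfolding \<alpha>_def t_def using c by (intro mult_right_mono) auto
  then have "\<beta> \<le> ln 2 / (8 * c)" using t by (simp add: \<beta>_def divide_le_eq mult.commute)
  then have \<beta>2: "exp (\<beta> * (4 * c)) < 2" by (rule small)
  let ?w = "\<lambda>x. epowr (ennreal (infdist x E)) (- \<alpha>)"
  obtain K where K: "0 < K" "\<And>Q. is_cube Q \<Longrightarrow> \<exists>r>0.
    (\<integral>\<^sup>+x\<in>Q. ?w x \<partial>lebesgue) \<le> ennreal (K * r powr (- \<alpha>) * side Q ^ CARD('n)) \<and>
    (\<integral>\<^sup>+x\<in>Q. epowr (ennreal (infdist x E)) \<beta> \<partial>lebesgue) \<le> ennreal (K * r powr \<beta> * side Q ^ CARD('n))"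
    using infdist_powr_integrals_cube[OF E null C s(1) s' ratio' \<alpha>0 _ \<beta>0] \<alpha>2 \<beta>2 unfolding c_def by blast
  have inv: "epowr (?w x) (- 1 / (p - 1)) = epowr (ennreal (infdist x E)) \<beta>" for x
    using epowr_epowr_uminus[of "- \<alpha>" "1 / t" "infdist x E"] \<alpha>0 t by (simp add: t_def \<beta>_def)
  have "?w \<in> Muckenhoupt p"
    unfolding Muckenhoupt_def
  proof (intro CollectI conjI)
    show "weight ?w"
      unfolding weight_def
    proof (intro conjI allI impI)
      show "?w \<in> borel_measurable lebesgue" by measurable
      \<comment> \<open>With a negative exponent positivity holds at every point: where the distance
        vanishes the weight is infinite.\<close>
      have "0 < ?w x" for x
        using \<alpha>0 infdist_nonneg[of x E] by (cases "infdist x E = 0") (auto simp: epowr_def epowr_ennreal less_le)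
      then show "AE x in lebesgue. 0 < ?w x" by simp
      fix X :: "(real ^ 'n) set" assume "compact X"
      then have "bounded X" by (rule compact_imp_bounded)
      then obtain B where B: "0 < B" "\<And>x. x \<in> X \<Longrightarrow> norm x \<le> B" by (auto simp: bounded_pos)
      let ?Q = "cube (\<chi> i. - B) (2 * B + 1) :: (real ^ 'n) set"
      have "X \<subseteq> ?Q"
      proof
        fix x assume "x \<in> X"
        have "- B \<le> x $ i \<and> x $ i < - B + (2 * B + 1)" for i
          using B(2)[OF \<open>x \<in> X\<close>] component_le_norm_cart[of x i] by auto
        then show "x \<in> ?Q" by (simp add: cube_def)
      qed
      have "is_cube ?Q" using B(1) by (intro is_cubeI) simp
      then obtain r where *: "(\<integral>\<^sup>+x\<in>?Q. ?w x \<partial>lebesgue) \<le> ennreal (K * r powr (- \<alpha>) * side ?Q ^ CARD('n))"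
        using K(2) by blast
      have "(\<integral>\<^sup>+x\<in>X. ?w x \<partial>lebesgue) \<le> (\<integral>\<^sup>+x\<in>?Q. ?w x \<partial>lebesgue)"
        using \<open>X \<subseteq> ?Q\<close> by (intro nn_integral_mono) (auto simp: indicator_def)
      also note *
      also have "ennreal (K * r powr (- \<alpha>) * side ?Q ^ CARD('n)) < \<infinity>" by simp
      finally show "(\<integral>\<^sup>+x\<in>X. ?w x \<partial>lebesgue) < \<infinity>" .
    qed
    show "\<exists>C>0. \<forall>Q. is_cube Q \<longrightarrow>
      (\<integral>\<^sup>+x\<in>Q. ?w x \<partial>lebesgue) / emeasure lebesgue Q *
      epowr ((\<integral>\<^sup>+x\<in>Q. epowr (?w x) (- 1 / (p - 1)) \<partial>lebesgue) / emeasure lebesgue Q) (p - 1) \<le> ennreal C"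
    proof (intro exI[of _ "K * K powr t"] conjI allI impI)
      show "0 < K * K powr t" using K(1) by simp
      fix Q :: "(real ^ 'n) set" assume Q: "is_cube Q"
      define m where "m = side Q ^ CARD('n)"
      have m: "0 < m" "emeasure lebesgue Q = ennreal m"
        using emeasure_is_cube[OF Q] side_pos[OF Q] by (auto simp: m_def)
      obtain r where r: "0 < r" "(\<integral>\<^sup>+x\<in>Q. ?w x \<partial>lebesgue) \<le> ennreal (K * r powr (- \<alpha>) * m)"
        "(\<integral>\<^sup>+x\<in>Q. epowr (ennreal (infdist x E)) \<beta> \<partial>lebesgue) \<le> ennreal (K * r powr \<beta> * m)"
        using K(2)[OF Q] unfolding m_def by blast
      have "(\<integral>\<^sup>+x\<in>Q. ?w x \<partial>lebesgue) / ennreal m * epowr ((\<integral>\<^sup>+x\<in>Q. epowr (ennreal (infdist x E)) \<beta> \<partial>lebesgue) / ennreal m) t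
          \<le> ennreal (K * r powr (- \<alpha>)) * ennreal ((K * r powr \<beta>) powr t)"
        using K(1) m(1) t by (intro mult_mono average_le epowr_le r) auto
      also have "\<dots> = ennreal (K * r powr (- \<alpha>) * (K * r powr \<beta>) powr t)"
        using K(1) by (intro ennreal_mult[symmetric]) auto
      \<comment> \<open>The size \<open>r\<close> disappears because
        \<open>\<beta> * t = \<alpha>\<close>.\<close>
      also have "K * r powr (- \<alpha>) * (K * r powr \<beta>) powr t = K * K powr t"
        using K(1) r(1) t by (simp add: powr_mult powr_powr \<beta>_def powr_minus_divide)
      finally show "(\<integral>\<^sup>+x\<in>Q. ?w x \<partial>lebesgue) / emeasure lebesgue Q *
          epowr ((\<integral>\<^sup>+x\<in>Q. epowr (?w x) (- 1 / (p - 1)) \<partial>lebesgue) / emeasure lebesgue Q) (p - 1) \<le> ennreal (K * K powr t)"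
        unfolding inv m(2) t_def .
    qed
  qed
  with \<alpha>0 show ?thesis by (intro exI[of _ "- \<alpha>"]) auto
qed

theorem theorem1p1:
  fixes E :: "(real ^ 'n) set"
  assumes "E \<noteq> {}"
  shows "(\<exists>C0 s. 0 < C0 \<and> 0 < s \<and> s < inverse (1 + 2 ^ CARD('n)) \<and>
            (\<forall>Q0. is_cube Q0 \<and> Q0 \<inter> closure E \<noteq> {} \<longrightarrow>
              0 < upper_scale E s Q0 / lower_scale E s Q0 \<and>
              upper_scale E s Q0 / lower_scale E s Q0 \<le> ennreal C0))
         \<longleftrightarrow>
         (\<forall>p>1. \<exists>\<theta>. \<theta> \<noteq> 0 \<and> (\<lambda>x. epowr (ennreal (infdist x E)) \<theta>) \<in> Muckenhoupt p)"
    (is "?I \<longleftrightarrow> ?II")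
proof
  assume ?I
  then obtain C0 s where "0 < s" "s < inverse (1 + 2 ^ CARD('n))"
    "\<And>Q0. is_cube Q0 \<Longrightarrow> Q0 \<inter> closure E \<noteq> {} \<Longrightarrow>
      0 < upper_scale E s Q0 / lower_scale E s Q0 \<and> upper_scale E s Q0 / lower_scale E s Q0 \<le> ennreal C0"
    by blast
  then show ?II
    using scale_bound_imp_Muckenhoupt[OF assms] by blast
next
  assume ?II
  then obtain \<theta> where "\<theta> \<noteq> 0" "(\<lambda>x. epowr (ennreal (infdist x E)) \<theta>) \<in> Muckenhoupt 2"
    by force
  then obtain C0 s where "0 < C0" "0 < s" "s < inverse (1 + 2 ^ CARD('n))"
    "\<And>Q0. is_cube Q0 \<Longrightarrow> Q0 \<inter> closure E \<noteq> {} \<Longrightarrow>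
      0 < upper_scale E s Q0 / lower_scale E s Q0 \<and> upper_scale E s Q0 / lower_scale E s Q0 \<le> ennreal C0"
    using Muckenhoupt_imp_scale_bound[OF assms] by metis
  then show ?I by blast
qed

end
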